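(* Let $m,n\ge 2$ be integers and let $\mathcal A$ be the equally spaced $m\times n$ lattice grid. Any two bimonotone triangulations $T,T'$ of $\mathcal A$ that use all points of $\mathcal A$ as vertices are connected by flips: there is a finite sequence $T=T_0,T_1,\dots,T_k=T'$ of bimonotone triangulations of $\mathcal A$, each using all points of $\mathcal A$ as vertices, such that $T_{i+1}$ is obtained from $T_i$ by a flip for every $0\le i<k$.
   Context: The $m\times n$ lattice grid is the point configuration of $m$ rows of $n$ points each, $\mathcal A=\{(i,j)\in\mathbb Z^2: 0\le i\le n-1,\ 0\le j\le m-1\}$. A subdivision of a finite point configuration $\mathcal A\subset\mathbb R^2$ is a collection of convex polygons (with nonempty interior) whose vertices lie in $\mathcal A$, such that the union of the polygons is the convex hull of $\mathcal A$ and each pair of distinct polygons either does not intersect or intersects exactly in a common vertex or a common side. A triangulation is a subdivision all of whose polygons are triangles. It uses all points of $\mathcal A$ if every point of $\mathcal A$ is a vertex of some triangle. A polygon is bimonotone if every one of its edges is vertical or has nonnegative slope; a triangulation is bimonotone if all of its triangles are bimonotone. A flip takes a (convex) quadrilateral in a triangulation, formed by two triangles sharing an edge that is one diagonal of the quadrilateral, and switches which of its two diagonals is included in the triangulation, i.e. replaces these two triangles by the two triangles obtained by cutting the quadrilateral along its other diagonal. *)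

theory Defs
  imports "HOL-Analysis.Analysis"
begin

type_synonym point = "real \<times> real"

definition lattice_grid :: "nat \<Rightarrow> nat \<Rightarrow> point set" where
  "lattice_grid m n =
     {(real_of_int i, real_of_int j) | i j. 0 \<le> i \<and> i \<le> int n - 1 \<and> 0 \<le> j \<and> j \<le> int m - 1}"

text \<open>Polygons are sets of points; their vertices are the extreme points and their sides
  are the one-dimensional faces (\<open>edge_of\<close>).\<close>

definition convex_polygon :: "point set \<Rightarrow> bool" where
  "convex_polygon P \<longleftrightarrow> polytope P \<and> interior P \<noteq> {}"

definition vertices :: "point set \<Rightarrow> point set" where
  "vertices P = {v. v extreme_point_of P}"

text \<open>Finiteness of the collection need not be required: for finite \<open>A\<close> there are only
  finitely many polygons with vertices in \<open>A\<close>.\<close>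

definition subdivision :: "point set \<Rightarrow> point set set \<Rightarrow> bool" where
  "subdivision A S \<longleftrightarrow>
     (\<forall>P\<in>S. convex_polygon P \<and> vertices P \<subseteq> A) \<and>
     \<Union>S = convex hull A \<and>
     (\<forall>P\<in>S. \<forall>Q\<in>S. P \<noteq> Q \<longrightarrow>
        P \<inter> Q = {} \<or>
        (\<exists>v. v \<in> vertices P \<and> v \<in> vertices Q \<and> P \<inter> Q = {v}) \<or>
        (\<exists>e. e edge_of P \<and> e edge_of Q \<and> P \<inter> Q = e))"

definition triangulation :: "point set \<Rightarrow> point set set \<Rightarrow> bool" where
  "triangulation A T \<longleftrightarrow> subdivision A T \<and> (\<forall>P\<in>T. 2 simplex P)"

definition uses_all_points :: "point set \<Rightarrow> point set set \<Rightarrow> bool" where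
  "uses_all_points A T \<longleftrightarrow> (\<forall>a\<in>A. \<exists>P\<in>T. a \<in> vertices P)"

definition vertical :: "point set \<Rightarrow> bool" where
  "vertical e \<longleftrightarrow> (\<forall>p\<in>e. \<forall>q\<in>e. fst p = fst q)"

definition nonneg_slope :: "point set \<Rightarrow> bool" where
  "nonneg_slope e \<longleftrightarrow>
     (\<forall>p\<in>e. \<forall>q\<in>e. p \<noteq> q \<longrightarrow> fst p \<noteq> fst q \<and> 0 \<le> (snd q - snd p) / (fst q - fst p))"

definition bimonotone_polygon :: "point set \<Rightarrow> bool" where
  "bimonotone_polygon P \<longleftrightarrow> (\<forall>e. e edge_of P \<longrightarrow> vertical e \<or> nonneg_slope e)"

definition bimonotone :: "point set set \<Rightarrow> bool" where
  "bimonotone T \<longleftrightarrow> (\<forall>P\<in>T. bimonotone_polygon P)"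

definition diagonal :: "point set \<Rightarrow> point \<Rightarrow> point \<Rightarrow> bool" where
  "diagonal Q v w \<longleftrightarrow>
     v \<in> vertices Q \<and> w \<in> vertices Q \<and> v \<noteq> w \<and> \<not> closed_segment v w edge_of Q"

text \<open>Here \<open>Q\<close> is a convex quadrilateral with diagonals \<open>ac\<close> and \<open>bd\<close>, so \<open>abc\<close>, \<open>acd\<close> are the two
  triangles into which \<open>ac\<close> cuts it, and \<open>abd\<close>, \<open>bcd\<close> those into which \<open>bd\<close> cuts it.\<close>

definition flip :: "point set set \<Rightarrow> point set set \<Rightarrow> bool" where
  "flip T T' \<longleftrightarrow>
     (\<exists>Q a b c d.
        convex_polygon Q \<and> vertices Q = {a, b, c, d} \<and> card {a, b, c, d} = 4 \<and>
        diagonal Q a c \<and> diagonal Q b d \<and>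
        convex hull {a, b, c} \<in> T \<and> convex hull {a, c, d} \<in> T \<and>
        T' = (T - {convex hull {a, b, c}, convex hull {a, c, d}})
               \<union> {convex hull {a, b, d}, convex hull {b, c, d}})"

definition full_bimonotone_triangulation :: "point set \<Rightarrow> point set set \<Rightarrow> bool" where
  "full_bimonotone_triangulation A T \<longleftrightarrow>
     triangulation A T \<and> uses_all_points A T \<and> bimonotone T"

end

(* By a lattice-point argument every triangle of a full bimonotone triangulation is unimodular, and since
   its sides are monotone its vertices form a chain p <= p + u <= p + u + v. Conversely, any cover of the
   grid rectangle by such triangles with disjoint interiors is automatically face-to-face and full, so
   flips can be checked on interiors only. Measure edges in the 1-norm. If a longest edge has length
   at least 3, then it is also the long edge of the triangle on its other side, so that triangle is p,
   p + v, p + u + v; unimodularity forces u <= v or v <= u, so the other diagonal of the parallelogram is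
   again monotone, and flipping to it makes the sum of the longest edges drop. The process ends at the
   unique triangulation whose edges have length at most 2, and flips are reversible. *)

theory Submission
  imports Defs
begin

subsection \<open>Unimodular chain triangles\<close>

text \<open>The 1-norm is linear on increasing vectors, so in a chain the edge from \<open>p\<close>
  to \<open>p + u + v\<close> is strictly longer than the other two. Two things could block a flip
  at that edge: it might lie on the boundary, or be a short edge of its neighbour. The first cannot
  happen because the rectangle is an interval of the product order and contains \<open>p + v\<close>
  along with \<open>p\<close> and \<open>p + u + v\<close>; the second is why a globally longest
  edge is taken. The neighbour then splits the same primitive vector \<open>w = u + v\<close> into a
  unimodular pair inside the box between 0 and \<open>w\<close>, and there are only two such
  splittings, one on each side of the edge. The other diagonal has direction \<open>u - v\<close>,
  which is monotone exactly if \<open>u\<close> and \<open>v\<close> are comparable. The only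
  incomparable unimodular pair of increasing vectors consists of the two unit vectors, whence the
  threshold 3.\<close>

definition pt :: "int \<times> int \<Rightarrow> point" where
  "pt x = (of_int (fst x), of_int (snd x))"

definition det2 :: "int \<times> int \<Rightarrow> int \<times> int \<Rightarrow> int" where
  "det2 u v = fst u * snd v - snd u * fst v"

text \<open>The vectors \<open>u\<close> and \<open>v\<close> are the consecutive steps of the
  chain, not the two sides leaving \<open>p\<close>. Swapping them mirrors the triangle in the
  midpoint of its long edge.\<close>

definition tri :: "int \<times> int \<Rightarrow> int \<times> int \<Rightarrow> int \<times> int \<Rightarrow> point set" where
  "tri p u v = convex hull {pt p, pt (p + u), pt (p + u + v)}"

definition chain_basis :: "int \<times> int \<Rightarrow> int \<times> int \<Rightarrow> bool" where
  "chain_basis u v \<longleftrightarrow> 0 \<le> u \<and> 0 \<le> v \<and> \<bar>det2 u v\<bar> = 1"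

definition comb :: "int \<times> int \<Rightarrow> int \<times> int \<Rightarrow> int \<times> int \<Rightarrow> real \<Rightarrow> real \<Rightarrow> point" where
  "comb p u v s t = pt p + s *\<^sub>R pt u + t *\<^sub>R pt v"

text \<open>Cramer's rule: for a chain basis the determinant is 1 or -1, so multiplying by it
  replaces the division, and lattice points visibly get integer coordinates.\<close>

definition fst_coord :: "int \<times> int \<Rightarrow> int \<times> int \<Rightarrow> int \<times> int \<Rightarrow> point \<Rightarrow> real" where
  "fst_coord p u v x = of_int (det2 u v) *
     ((fst x - of_int (fst p)) * of_int (snd v) - (snd x - of_int (snd p)) * of_int (fst v))"

definition snd_coord :: "int \<times> int \<Rightarrow> int \<times> int \<Rightarrow> int \<times> int \<Rightarrow> point \<Rightarrow> real" where
  "snd_coord p u v x = of_int (det2 u v) *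
     (of_int (fst u) * (snd x - of_int (snd p)) - of_int (snd u) * (fst x - of_int (fst p)))"

lemma pt_add: "pt (x + y) = pt x + pt y"
  by (simp add: pt_def)

lemma pt_eq_iff [simp]: "pt x = pt y \<longleftrightarrow> x = y"
  by (simp add: pt_def prod_eq_iff)

text \<open>With barycentric weights \<open>a\<close> on \<open>p + u\<close> and \<open>b\<close>
  on \<open>p + u + v\<close> the coordinates are \<open>s = a + b\<close> and \<open>t = b\<close>,
  so the triangle becomes the region of sorted pairs in the unit square.\<close>

lemma mem_tri: "x \<in> tri p u v \<longleftrightarrow> (\<exists>s t. 0 \<le> t \<and> t \<le> s \<and> s \<le> 1 \<and> x = comb p u v s t)"
proof -
  have "x \<in> tri p u v \<longleftrightarrow>
    (\<exists>a b. 0 \<le> a \<and> 0 \<le> b \<and> a + b \<le> 1 \<and> x = comb p u v (a + b) b)"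
    unfolding tri_def convex_hull_3_alt
    by (auto simp: pt_add comb_def algebra_simps)
  also have "\<dots> \<longleftrightarrow> (\<exists>s t. 0 \<le> t \<and> t \<le> s \<and> s \<le> 1 \<and> x = comb p u v s t)"
  proof
    assume "\<exists>s t. 0 \<le> t \<and> t \<le> s \<and> s \<le> 1 \<and> x = comb p u v s t"
    then obtain s t where "0 \<le> t" "t \<le> s" "s \<le> 1" "x = comb p u v s t" by blast
    then show "\<exists>a b. 0 \<le> a \<and> 0 \<le> b \<and> a + b \<le> 1 \<and> x = comb p u v (a + b) b"
      by (intro exI[of _ "s - t"] exI[of _ t]) auto
  next
    assume "\<exists>a b. 0 \<le> a \<and> 0 \<le> b \<and> a + b \<le> 1 \<and> x = comb p u v (a + b) b"
    then obtain a b where "0 \<le> a" "0 \<le> b" "a + b \<le> 1" "x = comb p u v (a + b) b" by blast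
    then show "\<exists>s t. 0 \<le> t \<and> t \<le> s \<and> s \<le> 1 \<and> x = comb p u v s t"
      by (intro exI[of _ "a + b"] exI[of _ b]) auto
  qed
  finally show ?thesis .
qed

lemma chain_basis_cases:
  assumes "chain_basis u v"
  obtains "det2 u v = 1" | "det2 u v = -1"
  using assms unfolding chain_basis_def by linarith

lemma comb_coords:
  assumes "chain_basis u v"
  shows "x = comb p u v s t \<longleftrightarrow> s = fst_coord p u v x \<and> t = snd_coord p u v x"
proof -
  obtain u1 u2 v1 v2 p1 p2 x1 x2 where e: "u = (u1,u2)" "v = (v1,v2)" "p = (p1,p2)" "x = (x1,x2)"
    by (metis surj_pair)
  define d :: real where "d = of_int (det2 u v)"
  have d: "d * d = 1"
    by (rule chain_basis_cases[OF assms]) (simp_all add: d_def)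
  have d2: "d = real_of_int u1 * real_of_int v2 - real_of_int u2 * real_of_int v1" by (simp add: d_def det2_def e)
  have F: "fst_coord p u v x = d * ((x1 - p1) * v2 - (x2 - p2) * v1)"
     and S: "snd_coord p u v x = d * (u1 * (x2 - p2) - u2 * (x1 - p1))"
    by (simp_all add: fst_coord_def snd_coord_def e d_def)
  have C: "x = comb p u v s t \<longleftrightarrow> x1 - p1 = s * u1 + t * v1 \<and> x2 - p2 = s * u2 + t * v2"
    by (auto simp: comb_def pt_def e)
  show ?thesis
  proof
    assume "x = comb p u v s t"
    then have h: "x1 - p1 = s * u1 + t * v1" "x2 - p2 = s * u2 + t * v2" using C by auto
    have "fst_coord p u v x = (d * d) * s" "snd_coord p u v x = (d * d) * t"
      unfolding F S h d2 by (simp_all add: algebra_simps)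
    then show "s = fst_coord p u v x \<and> t = snd_coord p u v x" using d by simp
  next
    assume h: "s = fst_coord p u v x \<and> t = snd_coord p u v x"
    have cramer:
      "(d * (x * b' - y * b)) * a + (d * (a * y - a'* x)) * b = d * (a * b' - a' * b) * x"
      "(d * (x * b' - y * b)) * a' + (d * (a * y - a'* x)) * b' = d * (a * b' - a' * b) * y"
      for a a' b b' x y :: real
      by (simp_all add: algebra_simps)
    have "s * u1 + t * v1 = (d * d) * (x1 - p1)" "s * u2 + t * v2 = (d * d) * (x2 - p2)"
      using cramer[where a = u1 and b = v1 and a' = u2 and b' = v2 and x = "x1 - p1" and y = "x2 - p2"] h
      unfolding F S d2[symmetric] by simp_all
    then show "x = comb p u v s t" using C d by simp
  qed
qed

lemma mem_tri_coords:
  assumes "chain_basis u v"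
  shows "x \<in> tri p u v \<longleftrightarrow>
    0 \<le> snd_coord p u v x \<and> snd_coord p u v x \<le> fst_coord p u v x \<and> fst_coord p u v x \<le> 1"
  unfolding mem_tri comb_coords[OF assms] by blast

lemma interior_tri:
  assumes "chain_basis u v"
  shows "x \<in> interior (tri p u v) \<longleftrightarrow> (\<exists>s t. 0 < t \<and> t < s \<and> s < 1 \<and> x = comb p u v s t)"
proof -
  define d :: real where "d = of_int (det2 u v)"
  have d0: "d \<noteq> 0" "d * d = 1"
    by (rule chain_basis_cases[OF assms]; simp add: d_def)+
  \<comment> \<open>Gradients of the two coordinate functions. The third normal \<open>b - a\<close>
    belongs to the long edge, where the coordinates agree; an intersection of half-planes with
    nonzero normals has the strict half-planes as its interior.\<close>
  define a b :: point where "a = (d * snd v, - d * fst v)" and "b = (- d * snd u, d * fst u)"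
  have F: "fst_coord p u v y = a \<bullet> y - a \<bullet> pt p"
    and S: "snd_coord p u v y = b \<bullet> y - b \<bullet> pt p" for y
    by (cases y, simp add: fst_coord_def snd_coord_def a_def b_def d_def pt_def algebra_simps)+
  have det: "real_of_int (fst u) * snd v - snd u * fst v \<noteq> 0"
    using d0 by (simp add: d_def det2_def flip: of_int_mult of_int_diff)
  then have nz: "a \<noteq> 0" "b \<noteq> 0" "a \<noteq> b"
  proof -
    show "a \<noteq> 0" "b \<noteq> 0" using det d0 by (auto simp: a_def b_def prod_eq_iff)
    show "a \<noteq> b"
    proof
      assume "a = b"
      then have "d * (real_of_int (snd v)) = d * (- real_of_int (snd u))" "d * (real_of_int (fst v)) = d * (- real_of_int (fst u))"
        by (simp_all add: a_def b_def)
      then have "real_of_int (snd v) = - snd u" "real_of_int (fst v) = - fst u"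
        using d0(1) by (simp_all only: mult_cancel_left) auto
      then show False using det by simp
    qed
  qed
  have eq: "tri p u v = {y. b \<bullet> y \<ge> b \<bullet> pt p} \<inter> {y. (b - a) \<bullet> y \<le> (b - a) \<bullet> pt p} \<inter> {y. a \<bullet> y \<le> a \<bullet> pt p + 1}"
    unfolding set_eq_iff Int_iff mem_Collect_eq mem_tri_coords[OF assms] F S inner_diff_left by (intro allI) argo
  have int: "interior (tri p u v) = {y. b \<bullet> y > b \<bullet> pt p} \<inter> {y. (b - a) \<bullet> y < (b - a) \<bullet> pt p} \<inter> {y. a \<bullet> y < a \<bullet> pt p + 1}"
  proof -
    have "b - a \<noteq> 0" using nz by simp
    show ?thesis
      unfolding eq interior_Int interior_halfspace_le[OF \<open>b - a \<noteq> 0\<close>]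
        interior_halfspace_le[OF nz(1)] interior_halfspace_ge[OF nz(2)] by (rule refl)
  qed
  have "x \<in> interior (tri p u v) \<longleftrightarrow>
    0 < snd_coord p u v x \<and> snd_coord p u v x < fst_coord p u v x \<and> fst_coord p u v x < 1"
    unfolding int F S inner_diff_left Int_iff mem_Collect_eq by argo
  then show ?thesis unfolding comb_coords[OF assms] by blast
qed

text \<open>Unimodularity makes both coordinates integers, and sorted integers between 0 and 1 leave
  just the three corners.\<close>

lemma lattice_point_in_tri:
  assumes "chain_basis u v" "pt z \<in> tri p u v"
  shows "z \<in> {p, p + u, p + u + v}"
proof -
  define i j where "i = det2 u v * det2 (z - p) v" and "j = det2 u v * det2 u (z - p)"
  have F: "fst_coord p u v (pt z) = of_int i" and S: "snd_coord p u v (pt z) = of_int j"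
    by (simp_all add: fst_coord_def snd_coord_def i_def j_def pt_def det2_def)
  have c: "0 \<le> j" "j \<le> i" "i \<le> 1"
    using assms F S by (simp_all add: mem_tri_coords)
  have "pt z = comb p u v (of_int i) (of_int j)"
    using comb_coords[OF assms(1)] F S by metis
  moreover from c have "i = 0 \<and> j = 0 \<or> i = 1 \<and> j = 0 \<or> i = 1 \<and> j = 1" by arith
  ultimately show ?thesis by (auto simp: comb_def pt_add [symmetric])
qed

text \<open>Taking the middle vertex of the chain as origin turns collinearity of the vertices into
  parallelism of \<open>u\<close> and \<open>v\<close>.\<close>

lemma affine_independent_chain:
  "\<not> affine_dependent {pt p, pt (p + u), pt (p + u + v)} \<and>
     card {pt p, pt (p + u), pt (p + u + v)} = 3 \<longleftrightarrow> det2 u v \<noteq> 0"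
proof -
  have "collinear {pt p, pt (p + u), pt (p + u + v)} \<longleftrightarrow> collinear {0, - pt u, pt v}"
    by (subst collinear_3) (simp_all add: pt_add)
  also have "\<dots> \<longleftrightarrow> det2 u v = 0"
  proof -
    obtain a b c d where e: "u = (a,b)" "v = (c,d)" by (metis surj_pair)
    have R: "det2 u v = 0 \<longleftrightarrow> real_of_int a * real_of_int d = real_of_int b * real_of_int c"
      by (simp add: det2_def e flip: of_int_mult)
    show ?thesis
    proof
      assume "collinear {0, - pt u, pt v}"
      then show "det2 u v = 0"
        unfolding collinear_lemma R by (auto simp: pt_def e zero_prod_def)
    next
      assume D: "det2 u v = 0"
      show "collinear {0, - pt u, pt v}"
      proof (cases "a = 0")
        case False
        have "real_of_int a * real_of_int d = real_of_int b * real_of_int c" using D R by simp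
        then have "pt v = (- c / a) *\<^sub>R (- pt u)"
          using False by (simp add: pt_def e divide_simps mult.commute)
        then show ?thesis unfolding collinear_lemma by blast
      next
        case True
        show ?thesis
        proof (cases "b = 0")
          case False
          have "real_of_int a * real_of_int d = real_of_int b * real_of_int c" using D R by simp
          then have "pt v = (- d / b) *\<^sub>R (- pt u)"
            using False True by (simp add: pt_def e)
          then show ?thesis unfolding collinear_lemma by blast
        next
          case b: True
          show ?thesis unfolding collinear_lemma by (simp add: pt_def e True b zero_prod_def)
        qed
      qed
    qed
  qed
  finally show ?thesis
    unfolding collinear_3_eq_affine_dependent
    by (auto simp: card_insert_if)
qed

subsection \<open>Triangles with disjoint interiors meet face-to-face\<close>

lemma tri_affine_independent:
  assumes "chain_basis u v"
  shows "\<not> affine_dependent {pt p, pt (p + u), pt (p + u + v)}"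
    and "card {pt p, pt (p + u), pt (p + u + v)} = 3"
proof -
  have "det2 u v \<noteq> 0"
    using assms by (auto simp: chain_basis_def)
  then show "\<not> affine_dependent {pt p, pt (p + u), pt (p + u + v)}"
    and "card {pt p, pt (p + u), pt (p + u + v)} = 3"
    using affine_independent_chain[of p u v] by blast+
qed

lemma simplex_tri: "chain_basis u v \<Longrightarrow> 2 simplex (tri p u v)"
  unfolding simplex_def tri_def
  by (rule exI[of _ "{pt p, pt (p + u), pt (p + u + v)}"]) (simp add: tri_affine_independent)

lemma vertices_tri:
  "chain_basis u v \<Longrightarrow> vertices (tri p u v) = {pt p, pt (p + u), pt (p + u + v)}"
  unfolding vertices_def tri_def
  by (auto simp: extreme_point_of_convex_hull_affine_independent[OF tri_affine_independent(1)])

lemma interior_tri_nonempty: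
  assumes "chain_basis u v"
  shows "interior (tri p u v) \<noteq> {}"
proof -
  have "comb p u v (2/3) (1/3) \<in> interior (tri p u v)"
    unfolding interior_tri[OF assms] by (intro exI[of _ "2/3"] exI[of _ "1/3"]) simp
  then show ?thesis by blast
qed

lemma convex_tri: "convex (tri p u v)" and compact_tri: "compact (tri p u v)"
  by (simp_all add: tri_def finite_imp_compact_convex_hull)

lemma convex_polygon_tri: "chain_basis u v \<Longrightarrow> convex_polygon (tri p u v)"
  unfolding convex_polygon_def
  using interior_tri_nonempty simplex_tri simplex_imp_polytope by blast

section \<open>Faces and edges of a triangle\<close>

lemma aff_dim_segment: "v \<noteq> w \<Longrightarrow> aff_dim (closed_segment v w) = 1"
  for v w :: "'a::euclidean_space"
  by (simp add: segment_convex_hull aff_dim_convex_hull aff_dim_2)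

lemma convex_hull_subset_3:
  assumes "c \<subseteq> {x, y, z}" "c \<noteq> {x, y, z}" and "x \<noteq> y" "y \<noteq> z" "x \<noteq> z"
  shows "convex hull c = {} \<or> (\<exists>a\<in>{x,y,z}. convex hull c = {a}) \<or>
    (\<exists>a\<in>{x,y,z}. \<exists>b\<in>{x,y,z}. a \<noteq> b \<and> convex hull c = closed_segment a b)"
proof -
  have "c \<in> Pow {x, y, z}" using assms by blast
  then have "c = {} \<or> c = {x} \<or> c = {y} \<or> c = {z} \<or> c = {x,y} \<or> c = {y,z} \<or> c = {x,z}"
    using assms(2) unfolding Pow_insert Pow_empty by auto
  then show ?thesis using assms(3-)
    by (elim disjE) (auto simp: segment_convex_hull)
qed

lemma face_of_triangle:
  fixes x y z :: "'a::euclidean_space"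
  assumes ind: "\<not> affine_dependent {x, y, z}" and card: "card {x, y, z} = 3"
    and F: "F face_of convex hull {x, y, z}" "F \<noteq> convex hull {x, y, z}"
  shows "F = {} \<or> (\<exists>a\<in>{x,y,z}. F = {a}) \<or>
    (\<exists>a\<in>{x,y,z}. \<exists>b\<in>{x,y,z}. a \<noteq> b \<and> F = closed_segment a b)"
proof -
  obtain c where c: "c \<subseteq> {x, y, z}" "F = convex hull c"
    using F(1) face_of_convex_hull_affine_independent[OF ind] by blast
  moreover have "x \<noteq> y" "y \<noteq> z" "x \<noteq> z" using card by (auto simp: card_insert_if split: if_splits)
  moreover have "c \<noteq> {x, y, z}" using c F(2) by blast
  ultimately show ?thesis using convex_hull_subset_3 by metis
qed

lemma edge_of_triangle:
  fixes x y z :: "'a::euclidean_space"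
  assumes ind: "\<not> affine_dependent {x, y, z}" and card: "card {x, y, z} = 3"
  shows "e edge_of convex hull {x, y, z} \<longleftrightarrow>
    (\<exists>a\<in>{x,y,z}. \<exists>b\<in>{x,y,z}. a \<noteq> b \<and> e = closed_segment a b)"
proof
  assume e: "e edge_of convex hull {x, y, z}"
  have "aff_dim (convex hull {x, y, z}) = 2"
    using aff_dim_affine_independent[OF ind] card by (simp add: aff_dim_convex_hull)
  then have "e face_of convex hull {x, y, z}" "e \<noteq> convex hull {x, y, z}"
    using e by (auto simp: edge_of_def)
  from face_of_triangle[OF ind card this] show "\<exists>a\<in>{x,y,z}. \<exists>b\<in>{x,y,z}. a \<noteq> b \<and> e = closed_segment a b"
    using e by (auto simp: edge_of_def)
next
  assume "\<exists>a\<in>{x,y,z}. \<exists>b\<in>{x,y,z}. a \<noteq> b \<and> e = closed_segment a b"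
  then obtain a b where "a \<in> {x,y,z}" "b \<in> {x,y,z}" "a \<noteq> b" "e = closed_segment a b" by blast
  then show "e edge_of convex hull {x, y, z}"
    unfolding edge_of_def face_of_convex_hull_affine_independent[OF ind]
    by (auto simp: aff_dim_segment simp del: insert_iff intro!: exI[of _ "{a, b}"] simp flip: segment_convex_hull)
qed

lemma face_of_tri:
  assumes "chain_basis u v" "F face_of tri p u v" "F \<noteq> tri p u v"
  shows "F = {} \<or> (\<exists>a\<in>vertices (tri p u v). F = {a}) \<or>
    (\<exists>a\<in>vertices (tri p u v). \<exists>b\<in>vertices (tri p u v). a \<noteq> b \<and> F = closed_segment a b)"
  unfolding vertices_tri[OF assms(1)]
  by (rule face_of_triangle[OF tri_affine_independent[OF assms(1)]])
    (use assms in \<open>simp_all only: tri_def not_False_eq_True\<close>)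

lemma edge_of_tri:
  assumes "chain_basis u v"
  shows "e edge_of tri p u v \<longleftrightarrow>
    (\<exists>a\<in>vertices (tri p u v). \<exists>b\<in>vertices (tri p u v). a \<noteq> b \<and> e = closed_segment a b)"
  unfolding vertices_tri[OF assms(1)] unfolding tri_def
  by (rule edge_of_triangle[OF tri_affine_independent[OF assms]])

text \<open>Rotating the normal \<open>a\<close> by a right angle gives a linear coordinate along
  the line, in which segments become real intervals.\<close>

lemma segment_on_line:
  fixes a v w x :: point
  assumes a: "a \<noteq> 0" and line: "a \<bullet> v = b" "a \<bullet> w = b"
  shows "x \<in> closed_segment v w \<longleftrightarrow>
    a \<bullet> x = b \<and> (- snd a, fst a) \<bullet> x \<in> closed_segment ((- snd a, fst a) \<bullet> v) ((- snd a, fst a) \<bullet> w)"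
proof
  assume "x \<in> closed_segment v w"
  then obtain k where k: "0 \<le> k" "k \<le> 1" "x = (1 - k) *\<^sub>R v + k *\<^sub>R w"
    by (auto simp: closed_segment_def)
  have "a \<bullet> x = (1 - k) * b + k * b"
    unfolding k(3) inner_add_right inner_scaleR_right line by simp
  then have "a \<bullet> x = b" by (simp add: algebra_simps)
  moreover have "f \<bullet> x = (1 - k) *\<^sub>R (f \<bullet> v) + k *\<^sub>R (f \<bullet> w)" for f
    unfolding k(3) inner_add_right inner_scaleR_right by simp
  ultimately show "a \<bullet> x = b \<and> (- snd a, fst a) \<bullet> x \<in> closed_segment ((- snd a, fst a) \<bullet> v) ((- snd a, fst a) \<bullet> w)"
    using k(1,2) unfolding closed_segment_def mem_Collect_eq by blast
next
  assume h: "a \<bullet> x = b \<and> (- snd a, fst a) \<bullet> x \<in> closed_segment ((- snd a, fst a) \<bullet> v) ((- snd a, fst a) \<bullet> w)"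
  then obtain k where k: "0 \<le> k" "k \<le> 1"
    and e: "(- snd a, fst a) \<bullet> x = (1 - k) * ((- snd a, fst a) \<bullet> v) + k * ((- snd a, fst a) \<bullet> w)"
    by (auto simp: closed_segment_def)
  define y where "y = x - ((1 - k) *\<^sub>R v + k *\<^sub>R w)"
  have "a \<bullet> y = b - ((1 - k) * b + k * b)"
    unfolding y_def inner_diff_right inner_add_right inner_scaleR_right line using h by simp
  then have 1: "fst a * fst y + snd a * snd y = 0"
    by (cases a; cases y) (simp add: algebra_simps)
  have "(- snd a, fst a) \<bullet> y = 0"
    unfolding y_def inner_diff_right inner_add_right inner_scaleR_right e by simp
  then have 2: "fst a * snd y - snd a * fst y = 0"
    by (cases a; cases y) (simp add: algebra_simps)
  \<comment> \<open>\<open>y\<close> is orthogonal to \<open>a\<close> and to its rotation, so its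
    coordinates vanish after multiplication by the squared norm of \<open>a\<close>.\<close>
  have "(fst a * fst a + snd a * snd a) * fst y = 0" "(fst a * fst a + snd a * snd a) * snd y = 0"
    using 1 2 by algebra+
  moreover have "fst a * fst a + snd a * snd a \<noteq> 0"
    using a by (auto simp: prod_eq_iff sum_squares_eq_zero_iff)
  ultimately have "y = 0" by (auto simp: prod_eq_iff)
  then show "x \<in> closed_segment v w"
    using k by (auto simp: y_def closed_segment_def)
qed

text \<open>Along the line this is an intersection of two intervals. It runs from the larger of the
  left ends to the smaller of the right ends, and both are endpoints of the given segments.\<close>

lemma collinear_segments_Int:
  fixes a v w v' w' :: point
  assumes a: "a \<noteq> 0" and line: "a \<bullet> v = b" "a \<bullet> w = b" "a \<bullet> v' = b" "a \<bullet> w' = b"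
    and ne: "closed_segment v w \<inter> closed_segment v' w' \<noteq> {}"
  obtains y z where "y \<in> {v, w, v', w'}" "z \<in> {v, w, v', w'}"
    "closed_segment v w \<inter> closed_segment v' w' = closed_segment y z"
proof -
  define f where "f x = (- snd a, fst a) \<bullet> x" for x
  have sorted: "\<exists>v0 w0. v0 \<in> {v, w} \<and> w0 \<in> {v, w} \<and> closed_segment v w = closed_segment v0 w0 \<and> f v0 \<le> f w0" for v w
  proof (cases "f v \<le> f w")
    case True
    then show ?thesis by blast
  next
    case False
    then have "f w \<le> f v" by simp
    then show ?thesis using closed_segment_commute[of v w] by blast
  qed
  obtain v0 w0 where 0: "v0 \<in> {v, w}" "w0 \<in> {v, w}" "closed_segment v w = closed_segment v0 w0" "f v0 \<le> f w0"
    using sorted by blast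
  obtain v1 w1 where 1: "v1 \<in> {v', w'}" "w1 \<in> {v', w'}" "closed_segment v' w' = closed_segment v1 w1" "f v1 \<le> f w1"
    using sorted by blast
  have seg: "x \<in> closed_segment c d \<longleftrightarrow> a \<bullet> x = b \<and> f c \<le> f x \<and> f x \<le> f d"
    if "a \<bullet> c = b" "a \<bullet> d = b" "f c \<le> f d" for c d x
    using segment_on_line[OF a that(1,2), of x] that(3)
    by (auto simp: f_def closed_segment_eq_real_ivl)
  have l: "a \<bullet> v0 = b" "a \<bullet> w0 = b" "a \<bullet> v1 = b" "a \<bullet> w1 = b"
    using 0 1 line by auto
  define y where "y = (if f v0 \<le> f v1 then v1 else v0)"
  define z where "z = (if f w0 \<le> f w1 then w0 else w1)"
  obtain x where "x \<in> closed_segment v0 w0" "x \<in> closed_segment v1 w1"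
    using ne 0(3) 1(3) by auto
  then have "f v0 \<le> f x" "f v1 \<le> f x" "f x \<le> f w0" "f x \<le> f w1"
    using seg[OF l(1,2) 0(4)] seg[OF l(3,4) 1(4)] by blast+
  moreover have fy: "f y = max (f v0) (f v1)" and fz: "f z = min (f w0) (f w1)"
    by (simp_all add: y_def z_def)
  ultimately have le: "f y \<le> f z" by linarith
  have yz: "a \<bullet> y = b" "a \<bullet> z = b" using l by (simp_all add: y_def z_def)
  have eq: "closed_segment v0 w0 \<inter> closed_segment v1 w1 = closed_segment y z"
    unfolding set_eq_iff Int_iff seg[OF l(1,2) 0(4)] seg[OF l(3,4) 1(4)] seg[OF yz le]
      fy fz max.bounded_iff min.bounded_iff by blast
  have "y \<in> {v0, v1}" "z \<in> {w0, w1}" by (simp_all add: y_def z_def)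
  then have "y \<in> {v, w, v', w'}" "z \<in> {v, w, v', w'}" using 0(1,2) 1(1,2) by blast+
  then show ?thesis by (rule that) (simp only: 0(3) 1(3) eq)
qed

text \<open>A unimodular triangle contains no lattice points besides its vertices. This is what
  rules out a vertex in the middle of another triangle's side.\<close>

lemma vertex_of_tri_in_tri:
  assumes "chain_basis u v" "chain_basis u' v'"
    and "x \<in> vertices (tri p u v)" "x \<in> tri p' u' v'"
  shows "x \<in> vertices (tri p' u' v')"
proof -
  obtain z where z: "x = pt z" using assms(3) unfolding vertices_tri[OF assms(1)] by blast
  then have "z \<in> {p', p' + u', p' + u' + v'}"
    using lattice_point_in_tri[OF assms(2)] assms(4) by blast
  then show ?thesis unfolding vertices_tri[OF assms(2)] z by blast
qed

text \<open>The interiors are separated first; the bounds pass to their closures, which are the sets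
  themselves.\<close>

lemma separating_hyperplane_interiors:
  fixes S T :: "'a::euclidean_space set"
  assumes "convex S" "convex T" "closed S" "closed T" "interior S \<noteq> {}" "interior T \<noteq> {}"
    and "interior S \<inter> interior T = {}"
  shows "\<exists>a b. a \<noteq> 0 \<and> (\<forall>x\<in>S. a \<bullet> x \<le> b) \<and> (\<forall>x\<in>T. a \<bullet> x \<ge> b)"
proof -
  obtain a b where ab: "a \<noteq> 0" "\<forall>x\<in>interior S. a \<bullet> x \<le> b" "\<forall>x\<in>interior T. a \<bullet> x \<ge> b"
    using separating_hyperplane_sets[OF assms(1,2)[THEN convex_interior] assms(5-7)] by blast
  have "closure (interior S) \<subseteq> {x. a \<bullet> x \<le> b}" "closure (interior T) \<subseteq> {x. a \<bullet> x \<ge> b}"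
    using ab closed_halfspace_le closed_halfspace_ge by (intro closure_minimal; blast)+
  then have "S \<subseteq> {x. a \<bullet> x \<le> b}" "T \<subseteq> {x. a \<bullet> x \<ge> b}"
    unfolding convex_closure_interior[OF assms(1,5)] convex_closure_interior[OF assms(2,6)]
      closure_closed[OF assms(3)] closure_closed[OF assms(4)] .
  then show ?thesis using ab(1) by blast
qed

text \<open>If the triangles meet, a separating line cuts each of them in a nonempty face, and their
  intersection is that of the two faces. Neither face is a whole triangle, as a line has empty
  interior. So each is a vertex or a side, and two sides on the line overlap in a segment or point
  whose ends are vertices of both triangles.\<close>

lemma tri_Int:
  assumes cb: "chain_basis u v" "chain_basis u' v'"
    and disj: "interior (tri p u v) \<inter> interior (tri p' u' v') = {}"
  defines "P \<equiv> tri p u v" and "Q \<equiv> tri p' u' v'"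
  shows "P \<inter> Q = {} \<or> (\<exists>x. x \<in> vertices P \<and> x \<in> vertices Q \<and> P \<inter> Q = {x}) \<or>
    (\<exists>e. e edge_of P \<and> e edge_of Q \<and> P \<inter> Q = e)"
proof (cases "P \<inter> Q = {}")
  case False
  have "convex P" "convex Q" "closed P" "closed Q" "interior P \<noteq> {}" "interior Q \<noteq> {}"
    unfolding P_def Q_def
    by (simp_all add: convex_tri compact_tri compact_imp_closed interior_tri_nonempty cb)
  from separating_hyperplane_interiors[OF this disj[folded P_def Q_def]]
  obtain a b where ab: "a \<noteq> 0" "\<forall>x\<in>P. a \<bullet> x \<le> b" "\<forall>x\<in>Q. a \<bullet> x \<ge> b"
    by (elim exE conjE)
  define F where "F = P \<inter> {x. a \<bullet> x = b}"
  define G where "G = Q \<inter> {x. a \<bullet> x = b}"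
  have "a \<bullet> x = b" if "x \<in> P" "x \<in> Q" for x
    using ab(2,3) that by (simp add: order_antisym)
  then have int: "P \<inter> Q = F \<inter> G" unfolding F_def G_def by blast
  have "F face_of P" unfolding F_def
    by (rule face_of_Int_supporting_hyperplane_le) (use ab(2) convex_tri P_def in simp_all)
  moreover have "G face_of Q" unfolding G_def
    by (rule face_of_Int_supporting_hyperplane_ge) (use ab(3) convex_tri Q_def in simp_all)
  ultimately have faces: "F face_of P" "G face_of Q" .
  have "interior {x. a \<bullet> x = b} = {}" using ab(1) by (simp add: interior_hyperplane)
  then have thick: "S \<inter> {x. a \<bullet> x = b} \<noteq> S" if "interior S \<noteq> {}" for S
    using that interior_mono[of S "{x. a \<bullet> x = b}"] by auto
  have ne: "F \<noteq> P" "G \<noteq> Q"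
    unfolding F_def G_def by (rule thick, simp add: P_def Q_def interior_tri_nonempty cb)+
  have PQ: "x \<in> vertices Q" if "x \<in> vertices P" "x \<in> Q" for x
    using vertex_of_tri_in_tri[OF cb] that unfolding P_def Q_def by blast
  have QP: "x \<in> vertices P" if "x \<in> vertices Q" "x \<in> P" for x
    using vertex_of_tri_in_tri[OF cb(2,1)] that unfolding P_def Q_def by blast
  have nonempty: "F \<noteq> {}" "G \<noteq> {}" using False int by blast+
  have edges: "closed_segment c d edge_of P" "closed_segment c d edge_of Q"
    if "c \<in> vertices P" "d \<in> vertices P" "c \<in> vertices Q" "d \<in> vertices Q" "c \<noteq> d" for c d
    unfolding edge_of_tri[OF cb(1), of _ p, folded P_def] edge_of_tri[OF cb(2), of _ p', folded Q_def]
    by (rule bexI[OF _ that(1)], rule bexI[OF _ that(2)], simp add: that(5))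
      (rule bexI[OF _ that(3)], rule bexI[OF _ that(4)], simp add: that(5))
  show ?thesis
    using face_of_tri[OF cb(1), of _ p, folded P_def, OF faces(1) ne(1)]
  proof (elim disjE bexE conjE)
    assume "F = {}" then show ?thesis using nonempty by simp
  next
    fix x assume x: "x \<in> vertices P" "F = {x}"
    then have eq: "P \<inter> Q = {x}" using False int by simp
    then have "x \<in> vertices Q" using PQ[OF x(1)] by blast
    with x(1) eq show ?thesis by (intro disjI2 disjI1 exI conjI)
  next
    fix x y assume xy: "x \<in> vertices P" "y \<in> vertices P" "x \<noteq> y" "F = closed_segment x y"
    show ?thesis
      using face_of_tri[OF cb(2), of _ p', folded Q_def, OF faces(2) ne(2)]
    proof (elim disjE bexE conjE)
      assume "G = {}" then show ?thesis using nonempty by simp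
    next
      fix x assume x: "x \<in> vertices Q" "G = {x}"
      then have eq: "P \<inter> Q = {x}" using False int by auto
      then have "x \<in> vertices P" using QP[OF x(1)] by blast
      from this x(1) eq show ?thesis by (intro disjI2 disjI1 exI conjI)
    next
      fix x' y' assume xy': "x' \<in> vertices Q" "y' \<in> vertices Q" "x' \<noteq> y'" "G = closed_segment x' y'"
      have "x \<in> F" "y \<in> F" "x' \<in> G" "y' \<in> G" unfolding xy(4) xy'(4) by simp_all
      then have line: "a \<bullet> x = b" "a \<bullet> y = b" "a \<bullet> x' = b" "a \<bullet> y' = b"
        by (simp_all add: F_def G_def)
      have "closed_segment x y \<inter> closed_segment x' y' \<noteq> {}"
        using False unfolding int xy(4) xy'(4) .
      from collinear_segments_Int[OF ab(1) line this] obtain c d where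
        cd: "c \<in> {x, y, x', y'}" "d \<in> {x, y, x', y'}"
          "closed_segment x y \<inter> closed_segment x' y' = closed_segment c d" .
      have eq: "P \<inter> Q = closed_segment c d" unfolding int xy(4) xy'(4) by (rule cd(3))
      have "t \<in> vertices P \<and> t \<in> vertices Q" if "t \<in> {x, y, x', y'}" "t \<in> P \<inter> Q" for t
        using that PQ[of t] QP[of t] xy(1,2) xy'(1,2) by blast
      moreover have "c \<in> P \<inter> Q" "d \<in> P \<inter> Q" unfolding eq by simp_all
      ultimately have V: "c \<in> vertices P" "d \<in> vertices P" "c \<in> vertices Q" "d \<in> vertices Q"
        using cd(1,2) by blast+
      show ?thesis
      proof (cases "c = d")
        case True
        then have "P \<inter> Q = {c}" using eq by simp
        from V(1,3) this show ?thesis by (intro disjI2 disjI1 exI conjI)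
      next
        case False
        from edges[OF V False] eq show ?thesis by (intro disjI2 exI conjI)
      qed
    qed
  qed
qed simp

subsection \<open>Full bimonotone triangulations as tilings\<close>

definition tiling :: "point set \<Rightarrow> point set set \<Rightarrow> bool" where
  "tiling R T \<longleftrightarrow>
     (\<forall>P\<in>T. \<exists>p u v. chain_basis u v \<and> P = tri p u v) \<and> \<Union>T = R \<and>
     (\<forall>P\<in>T. \<forall>Q\<in>T. P \<noteq> Q \<longrightarrow> interior P \<inter> interior Q = {})"

section \<open>The grid and its rectangle\<close>

lemma convex_hull_lattice_grid:
  assumes "m \<ge> 1" "n \<ge> 1"
  shows "convex hull lattice_grid m n = {0..real n - 1} \<times> {0..real m - 1}"
proof
  show "convex hull lattice_grid m n \<subseteq> {0..real n - 1} \<times> {0..real m - 1}"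
  proof (rule hull_minimal)
    show "lattice_grid m n \<subseteq> {0..real n - 1} \<times> {0..real m - 1}"
    proof
      fix x assume "x \<in> lattice_grid m n"
      then obtain i j where x: "x = (real_of_int i, real_of_int j)" "0 \<le> i" "i \<le> int n - 1" "0 \<le> j" "j \<le> int m - 1"
        by (auto simp: lattice_grid_def)
      then have "real_of_int i \<le> real_of_int (int n - 1)" "real_of_int j \<le> real_of_int (int m - 1)"
        by (simp_all only: of_int_le_iff)
      then show "x \<in> {0..real n - 1} \<times> {0..real m - 1}" using x by simp
    qed
    show "convex ({0..real n - 1} \<times> {0..real m - 1})"
      by (intro convex_Times convex_real_interval)
  qed
next
  have hull: "{0..c} = convex hull {0, c}" if "0 \<le> c" for c :: real
    using that by (simp add: closed_segment_eq_real_ivl flip: segment_convex_hull)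
  \<comment> \<open>The rectangle is a product of two segments, hence the hull of its four corners,
    which are grid points.\<close>
  have "{0..real n - 1} \<times> {0..real m - 1} = convex hull ({0, real n - 1} \<times> {0, real m - 1})"
    using assms by (simp only: convex_hull_Times hull)
  also have "\<dots> \<subseteq> convex hull lattice_grid m n"
  proof (rule hull_mono)
    have "(real_of_int i, real_of_int j) \<in> lattice_grid m n"
      if "i \<in> {0, int n - 1}" "j \<in> {0, int m - 1}" for i j
      using that assms by (auto simp: lattice_grid_def)
    from this[of 0 0] this[of 0 "int m - 1"] this[of "int n - 1" 0] this[of "int n - 1" "int m - 1"]
    show "{0, real n - 1} \<times> {0, real m - 1} \<subseteq> lattice_grid m n"
      by auto
  qed
  finally show "{0..real n - 1} \<times> {0..real m - 1} \<subseteq> convex hull lattice_grid m n" .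
qed

lemma pt_in_lattice_grid:
  assumes "m \<ge> 1" "n \<ge> 1"
  shows "pt z \<in> lattice_grid m n \<longleftrightarrow> pt z \<in> convex hull lattice_grid m n"
proof
  assume "pt z \<in> convex hull lattice_grid m n"
  then have "0 \<le> real_of_int (fst z)" "real_of_int (fst z) \<le> real_of_int (int n - 1)"
    "0 \<le> real_of_int (snd z)" "real_of_int (snd z) \<le> real_of_int (int m - 1)"
    by (simp_all add: convex_hull_lattice_grid[OF assms] pt_def)
  then have "0 \<le> fst z" "fst z \<le> int n - 1" "0 \<le> snd z" "snd z \<le> int m - 1"
    by (simp_all only: of_int_le_iff of_int_0_le_iff)
  then show "pt z \<in> lattice_grid m n" unfolding lattice_grid_def pt_def by blast
qed (rule hull_inc)

lemma lattice_grid_pt: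
  assumes "x \<in> lattice_grid m n"
  obtains z where "x = pt z"
proof -
  from assms obtain i j where "x = (real_of_int i, real_of_int j)" unfolding lattice_grid_def by blast
  then have "x = pt (i, j)" by (simp add: pt_def)
  then show ?thesis by (rule that)
qed

lemma finite_lattice_grid: "finite (lattice_grid m n)"
proof -
  have "lattice_grid m n \<subseteq> pt ` ({0..int n} \<times> {0..int m})"
  proof
    fix x assume "x \<in> lattice_grid m n"
    then obtain i j where "x = (real_of_int i, real_of_int j)" "0 \<le> i" "i \<le> int n - 1" "0 \<le> j" "j \<le> int m - 1"
      unfolding lattice_grid_def by blast
    then have "x = pt (i, j)" "(i, j) \<in> {0..int n} \<times> {0..int m}" by (simp_all add: pt_def)
    then show "x \<in> pt ` ({0..int n} \<times> {0..int m})" by blast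
  qed
  then show ?thesis by (rule finite_subset) simp
qed

section \<open>Monotone segments and comparable lattice points\<close>

lemma chain_segment_monotone:
  assumes "a \<le> b"
  shows "vertical (closed_segment (pt a) (pt b)) \<or> nonneg_slope (closed_segment (pt a) (pt b))"
proof -
  define d where "d = (real_of_int (fst b - fst a), real_of_int (snd b - snd a))"
  have d: "0 \<le> fst d" "0 \<le> snd d" using assms by (auto simp: d_def less_eq_prod_def)
  \<comment> \<open>Two points of the segment differ by a real multiple of \<open>d\<close>, whose
    sign cancels in the slope quotient.\<close>
  have diff: "\<exists>r. fst q - fst p = r * fst d \<and> snd q - snd p = r * snd d"
    if pq: "p \<in> closed_segment (pt a) (pt b)" "q \<in> closed_segment (pt a) (pt b)" for p q
  proof -
    have on: "\<exists>k. x = pt a + k *\<^sub>R d" if x: "x \<in> closed_segment (pt a) (pt b)" for x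
    proof -
      have "pt b = pt a + d" by (simp add: pt_def d_def)
      moreover obtain k where "x = (1 - k) *\<^sub>R pt a + k *\<^sub>R pt b"
        using x unfolding closed_segment_def by blast
      ultimately have "x = pt a + k *\<^sub>R d" by (simp add: algebra_simps)
      then show ?thesis ..
    qed
    obtain k l where "p = pt a + k *\<^sub>R d" "q = pt a + l *\<^sub>R d"
      using on[OF pq(1)] on[OF pq(2)] by blast
    then have "fst q - fst p = (l - k) * fst d \<and> snd q - snd p = (l - k) * snd d"
      by (simp add: algebra_simps)
    then show ?thesis ..
  qed
  show ?thesis
  proof (cases "fst d = 0")
    case True
    then have "vertical (closed_segment (pt a) (pt b))"
      unfolding vertical_def using diff by fastforce
    then show ?thesis ..
  next
    case False
    have "nonneg_slope (closed_segment (pt a) (pt b))"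
      unfolding nonneg_slope_def
    proof (intro ballI impI)
      fix p q assume pq: "p \<in> closed_segment (pt a) (pt b)" "q \<in> closed_segment (pt a) (pt b)" "p \<noteq> q"
      obtain r where r: "fst q - fst p = r * fst d" "snd q - snd p = r * snd d" using diff pq by blast
      then have "r \<noteq> 0" using pq(3) by (auto simp: prod_eq_iff)
      then show "fst p \<noteq> fst q \<and> 0 \<le> (snd q - snd p) / (fst q - fst p)"
        using r False d by auto
    qed
    then show ?thesis ..
  qed
qed

lemma monotone_segment_chain:
  assumes "vertical (closed_segment (pt a) (pt b)) \<or> nonneg_slope (closed_segment (pt a) (pt b))"
  shows "a \<le> b \<or> b \<le> a"
proof (cases "fst a = fst b")
  case True
  then show ?thesis by (auto simp: less_eq_prod_def)
next
  case False
  have "\<not> vertical (closed_segment (pt a) (pt b))"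
  proof
    assume "vertical (closed_segment (pt a) (pt b))"
    then have "fst (pt a) = fst (pt b)" unfolding vertical_def using ends_in_segment by blast
    then show False using False by (simp add: pt_def)
  qed
  then have "nonneg_slope (closed_segment (pt a) (pt b))" using assms by blast
  moreover have "pt a \<noteq> pt b" using False by auto
  ultimately have "0 \<le> (snd (pt b) - snd (pt a)) / (fst (pt b) - fst (pt a))"
    unfolding nonneg_slope_def using ends_in_segment by blast
  then have "0 \<le> real_of_int (snd b - snd a) / real_of_int (fst b - fst a)"
    by (simp add: pt_def)
  then show ?thesis
    using False by (auto simp: zero_le_divide_iff less_eq_prod_def)
qed

lemma bimonotone_polygon_tri:
  assumes "chain_basis u v"
  shows "bimonotone_polygon (tri p u v)"
  unfolding bimonotone_polygon_def
proof (intro allI impI)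
  fix e assume "e edge_of tri p u v"
  then obtain a b where "a \<in> {pt p, pt (p + u), pt (p + u + v)}"
    "b \<in> {pt p, pt (p + u), pt (p + u + v)}" and e: "e = closed_segment a b"
    unfolding edge_of_tri[OF assms] vertices_tri[OF assms] by blast
  then obtain c d where cd: "c \<in> {p, p + u, p + u + v}" "d \<in> {p, p + u, p + u + v}" "a = pt c" "b = pt d"
    by blast
  have "p \<le> p + u" "p + u \<le> p + u + v" "p \<le> p + u + v"
    using assms by (simp_all add: chain_basis_def less_eq_prod_def)
  then have "c \<le> d \<or> d \<le> c"
    using cd(1,2) unfolding insert_iff empty_iff by (elim disjE) (simp_all only: order_refl simp_thms)
  then show "vertical e \<or> nonneg_slope e"
  proof
    assume "c \<le> d"
    then show ?thesis unfolding e cd(3,4) by (rule chain_segment_monotone)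
  next
    assume "d \<le> c"
    then show ?thesis
      unfolding e cd(3,4) by (subst (1 2) closed_segment_commute) (rule chain_segment_monotone)
  qed
qed

text \<open>Face-to-face is \<open>tri_Int\<close>. Every grid point lies in some tile, and a
  lattice point of a unimodular triangle is one of its vertices, so all points are used.\<close>

lemma tiling_imp_full:
  assumes mn: "m \<ge> 1" "n \<ge> 1" and T: "tiling (convex hull lattice_grid m n) T"
  shows "full_bimonotone_triangulation (lattice_grid m n) T"
proof -
  let ?A = "lattice_grid m n"
  have tri: "\<exists>p u v. chain_basis u v \<and> P = tri p u v" if "P \<in> T" for P
    using T that by (simp add: tiling_def)
  have vert: "vertices P \<subseteq> ?A" if P: "P \<in> T" for P
  proof
    fix x assume x: "x \<in> vertices P"
    obtain p u v where "chain_basis u v" "P = tri p u v" using tri P by blast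
    then obtain z where z: "x = pt z" using x vertices_tri by blast
    have "x \<in> P" using x by (simp add: vertices_def extreme_point_of_def)
    then have "x \<in> convex hull ?A" using T P unfolding tiling_def by blast
    then show "x \<in> ?A" using z pt_in_lattice_grid[OF mn] by blast
  qed
  have "subdivision ?A T"
    unfolding subdivision_def
  proof (intro conjI ballI impI)
    fix P assume P: "P \<in> T"
    then show "convex_polygon P" using tri convex_polygon_tri by blast
    show "vertices P \<subseteq> ?A" using vert P by blast
  next
    show "\<Union>T = convex hull ?A" using T by (simp add: tiling_def)
  next
    fix P Q assume PQ: "P \<in> T" "Q \<in> T" "P \<noteq> Q"
    obtain p u v where P: "chain_basis u v" "P = tri p u v" using tri PQ by blast
    obtain p' u' v' where Q: "chain_basis u' v'" "Q = tri p' u' v'" using tri PQ by blast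
    have "interior P \<inter> interior Q = {}" using T PQ by (simp add: tiling_def)
    then show "P \<inter> Q = {} \<or> (\<exists>v. v \<in> vertices P \<and> v \<in> vertices Q \<and> P \<inter> Q = {v}) \<or>
      (\<exists>e. e edge_of P \<and> e edge_of Q \<and> P \<inter> Q = e)"
      unfolding P(2) Q(2) by (rule tri_Int[OF P(1) Q(1)])
  qed
  moreover have "\<forall>P\<in>T. 2 simplex P" using tri simplex_tri by blast
  moreover have "uses_all_points ?A T"
    unfolding uses_all_points_def
  proof
    fix a assume a: "a \<in> ?A"
    then obtain z where z: "a = pt z" by (rule lattice_grid_pt)
    have "a \<in> \<Union>T" using a T by (simp add: tiling_def hull_inc)
    then obtain P where P: "P \<in> T" "a \<in> P" by blast
    obtain p u v where t: "chain_basis u v" "P = tri p u v" using tri P by blast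
    have "a \<in> vertices P"
      using lattice_point_in_tri[OF t(1), of z p] P(2) unfolding z t(2) vertices_tri[OF t(1)] by blast
    then show "\<exists>P\<in>T. a \<in> vertices P" using P by blast
  qed
  moreover have "bimonotone T" unfolding bimonotone_def using tri bimonotone_polygon_tri by blast
  ultimately show ?thesis by (simp add: full_bimonotone_triangulation_def triangulation_def)
qed

text \<open>Reducing the coordinates of an arbitrary lattice point modulo 1 puts it into the parallelogram
  spanned by \<open>u\<close> and \<open>v\<close>, hence it or its mirror image into the triangle.\<close>

lemma empty_triangle_unimodular:
  assumes D: "det2 u v \<noteq> 0"
    and empty: "\<And>z. pt z \<in> tri p u v \<Longrightarrow> z \<in> {p, p + u, p + u + v}"
  shows "\<bar>det2 u v\<bar> = 1"
proof -
  define D where "D = det2 u v"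
  \<comment> \<open>By Cramer's rule this divisibility says that \<open>x\<close> is an integer
    combination of \<open>u\<close> and \<open>v\<close>; for all \<open>x\<close> together, that
    the two generate the whole lattice.\<close>
  have key: "D dvd det2 x v \<and> D dvd det2 u x" for x
  proof -
    define s t where "s = real_of_int (det2 x v) / D" and "t = real_of_int (det2 u x) / D"
    define i j where "i = \<lfloor>s\<rfloor>" and "j = \<lfloor>t\<rfloor>"
    define y where "y = x - (i * fst u + j * fst v, i * snd u + j * snd v)"
    have R: "real_of_int D = real_of_int (fst u) * real_of_int (snd v) - real_of_int (snd u) * real_of_int (fst v)"
      by (simp add: D_def det2_def)
    have D0: "real_of_int D \<noteq> 0" using D by (simp add: D_def)
    have Ds: "real_of_int D * s = of_int (det2 x v)" and Dt: "real_of_int D * t = of_int (det2 u x)"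
      using D0 by (simp_all add: s_def t_def)
    have "real_of_int D * fst x = (real_of_int D * s) * fst u + (real_of_int D * t) * fst v"
      "real_of_int D * snd x = (real_of_int D * s) * snd u + (real_of_int D * t) * snd v"
      unfolding Ds Dt unfolding R det2_def by (simp_all add: algebra_simps)
    then have "real_of_int D * fst x = real_of_int D * (s * fst u + t * fst v)"
      "real_of_int D * snd x = real_of_int D * (s * snd u + t * snd v)"
      by (simp_all add: algebra_simps)
    then have "real_of_int (fst x) = s * fst u + t * fst v" "real_of_int (snd x) = s * snd u + t * snd v"
      unfolding mult_left_cancel[OF D0] .
    then have y: "pt (p + y) = comb p u v (s - i) (t - j)"
      by (simp add: pt_def comb_def y_def algebra_simps)
    \<comment> \<open>The mirror image in the centre of the parallelogram takes over when the
      reduced point lies on the far side of the diagonal.\<close>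
    then have y': "pt (p + (u + v - y)) = comb p u v (1 - (s - i)) (1 - (t - j))"
      by (simp add: pt_def comb_def algebra_simps)
    have frac: "0 \<le> s - i" "s - i < 1" "0 \<le> t - j" "t - j < 1"
      unfolding i_def j_def by linarith+
    have inj: "s' = s'' \<and> t' = t''" if "comb p u v s' t' = comb p u v s'' t''" for s' t' s'' t''
    proof -
      have 1: "(s' - s'') * fst u + (t' - t'') * fst v = 0" "(s' - s'') * snd u + (t' - t'') * snd v = 0"
        using that by (simp_all add: comb_def pt_def algebra_simps)
      have "(s' - s'') * D = snd v * ((s' - s'') * fst u + (t' - t'') * fst v)
          - fst v * ((s' - s'') * snd u + (t' - t'') * snd v)"
        "(t' - t'') * D = fst u * ((s' - s'') * snd u + (t' - t'') * snd v)
          - snd u * ((s' - s'') * fst u + (t' - t'') * fst v)"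
        unfolding R by (simp_all add: algebra_simps)
      then have "(s' - s'') * D = 0" "(t' - t'') * D = 0" unfolding 1 by simp_all
      then show ?thesis using D0 by simp
    qed
    have corner: "(s' = 0 \<or> s' = 1) \<and> (t' = 0 \<or> t' = 1)"
      if "0 \<le> t'" "t' \<le> s'" "s' \<le> 1" "pt z = comb p u v s' t'" for s' t' z
    proof -
      have "pt z \<in> tri p u v" unfolding mem_tri using that by blast
      then have "z \<in> {p, p + u, p + u + v}" by (rule empty)
      moreover have "pt p = comb p u v 0 0" "pt (p + u) = comb p u v 1 0" "pt (p + u + v) = comb p u v 1 1"
        by (simp_all add: comb_def pt_add)
      ultimately have "comb p u v s' t' \<in> {comb p u v 0 0, comb p u v 1 0, comb p u v 1 1}"
        using that(4) by force
      then show ?thesis using inj by blast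
    qed
    have "s - i = 0 \<and> t - j = 0"
    proof (cases "t - j \<le> s - i")
      case True
      then show ?thesis using corner[OF _ _ _ y] frac by linarith
    next
      case False
      then have "(1 - (s - i) = 0 \<or> 1 - (s - i) = 1) \<and> (1 - (t - j) = 0 \<or> 1 - (t - j) = 1)"
        using frac by (intro corner[OF _ _ _ y']) linarith+
      then show ?thesis using frac False by linarith
    qed
    then have "real_of_int (det2 x v) = real_of_int (D * i)" "real_of_int (det2 u x) = real_of_int (D * j)"
      using D0 unfolding s_def t_def by (simp_all add: field_simps)
    then have "det2 x v = D * i" "det2 u x = D * j" by (simp_all only: of_int_eq_iff)
    then show ?thesis by simp
  qed
  \<comment> \<open>For the two unit vectors, \<open>key\<close> makes \<open>D\<close> divide all
    four entries of the matrix, hence \<open>D * D\<close> divides its determinant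
    \<open>D\<close>.\<close>
  have "D dvd snd v" "D dvd snd u" using key[of "(1,0)"] by (simp_all add: det2_def)
  moreover have "D dvd fst v" "D dvd fst u" using key[of "(0,1)"] by (simp_all add: det2_def)
  ultimately have "D * D dvd fst u * snd v - snd u * fst v"
    by (intro dvd_diff mult_dvd_mono)
  then have "D * D dvd D * 1" by (simp only: det2_def [symmetric] D_def [symmetric] mult_1_right)
  moreover have "D \<noteq> 0" using D by (simp add: D_def)
  ultimately have "D dvd 1" unfolding dvd_mult_cancel_left by blast
  then show ?thesis by (simp add: D_def)
qed

section \<open>From triangulations to tilings\<close>

lemma sort_three:
  fixes a b c :: "'a::order"
  assumes "a \<le> b \<or> b \<le> a" "b \<le> c \<or> c \<le> b" "a \<le> c \<or> c \<le> a"
  shows "\<exists>p q r. p \<le> q \<and> q \<le> r \<and> {p, q, r} = {a, b, c}"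
proof -
  have "a \<le> b \<and> b \<le> c \<or> a \<le> c \<and> c \<le> b \<or> b \<le> a \<and> a \<le> c \<or> b \<le> c \<and> c \<le> a
    \<or> c \<le> a \<and> a \<le> b \<or> c \<le> b \<and> b \<le> a"
    using assms by blast
  moreover have "{a, c, b} = {a, b, c}" "{b, a, c} = {a, b, c}" "{b, c, a} = {a, b, c}"
    "{c, a, b} = {a, b, c}" "{c, b, a} = {a, b, c}"
    by blast+
  ultimately show ?thesis by blast
qed

lemma full_imp_tiling:
  assumes mn: "m \<ge> 1" "n \<ge> 1" and full: "full_bimonotone_triangulation (lattice_grid m n) T"
  shows "tiling (convex hull lattice_grid m n) T"
proof -
  let ?A = "lattice_grid m n"
  have sub: "subdivision ?A T" and simp: "\<And>P. P \<in> T \<Longrightarrow> 2 simplex P"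
    and all: "uses_all_points ?A T" and bi: "bimonotone T"
    using full by (auto simp: full_bimonotone_triangulation_def triangulation_def)
  have meet: "P \<inter> Q = {} \<or> (\<exists>v. v \<in> vertices P \<and> v \<in> vertices Q \<and> P \<inter> Q = {v}) \<or>
      (\<exists>e. e edge_of P \<and> e edge_of Q \<and> P \<inter> Q = e)" if "P \<in> T" "Q \<in> T" "P \<noteq> Q" for P Q
    using sub that unfolding subdivision_def by blast
  have un: "\<Union>T = convex hull ?A" using sub by (simp add: subdivision_def)
  have vertA: "vertices P \<subseteq> ?A" if "P \<in> T" for P using sub that by (simp add: subdivision_def)
  \<comment> \<open>As all points are used, the point is a vertex of some \<open>Q\<close>. If
    \<open>Q\<close> differs from \<open>P\<close>, the point lies in the common face
    \<open>P \<inter> Q\<close>, and being extreme passes from \<open>Q\<close> to that face and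
    back up to \<open>P\<close>.\<close>
  have lattice: "pt z \<in> vertices P" if P: "P \<in> T" "pt z \<in> P" for P z
  proof -
    have "pt z \<in> ?A" using that un pt_in_lattice_grid[OF mn] by blast
    then obtain Q where Q: "Q \<in> T" "pt z \<in> vertices Q" using all unfolding uses_all_points_def by blast
    then have zQ: "pt z \<in> Q" by (simp add: vertices_def extreme_point_of_def)
    show ?thesis
    proof (cases "P = Q")
      case False
      from meet[OF P(1) Q(1) False] show ?thesis
      proof (elim disjE exE conjE)
        fix e assume e: "e edge_of P" "e edge_of Q" "P \<inter> Q = e"
        have "pt z \<in> e" using e(3) P(2) zQ by blast
        then have "pt z extreme_point_of e"
          using extreme_point_of_face[of e Q] e(2) Q(2) by (auto simp: edge_of_def vertices_def)
        then show ?thesis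
          using extreme_point_of_face[of e P] e(1) by (auto simp: edge_of_def vertices_def)
      next
        fix v assume v: "v \<in> vertices P" "P \<inter> Q = {v}"
        then have "pt z = v" using P(2) zQ by blast
        then show ?thesis using v(1) by simp
      qed (use P(2) zQ in blast)
    qed (use Q in simp)
  qed
  have "\<exists>p u v. chain_basis u v \<and> P = tri p u v" if P: "P \<in> T" for P
  proof -
    obtain C where C: "\<not> affine_dependent C" "int (card C) = 2 + 1" "P = convex hull C"
      using simp[OF P] unfolding simplex_def by blast
    then have VC: "vertices P = C"
      by (simp add: vertices_def extreme_point_of_convex_hull_affine_independent)
    have "card C = 3" using C(2) by simp
    then obtain x y z where xyz: "C = {x, y, z}" "x \<noteq> y" "y \<noteq> z" "x \<noteq> z"
      unfolding card_3_iff by blast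
    then have A: "x \<in> ?A" "y \<in> ?A" "z \<in> ?A" using vertA[OF P] VC by blast+
    obtain a where a: "x = pt a" using A(1) by (rule lattice_grid_pt)
    obtain b where b: "y = pt b" using A(2) by (rule lattice_grid_pt)
    obtain c where c: "z = pt c" using A(3) by (rule lattice_grid_pt)
    note abc = a b c
    have comp: "s \<le> t \<or> t \<le> s" if st: "s \<in> {a, b, c}" "t \<in> {a, b, c}" for s t
    proof (cases "s = t")
      case False
      have mem: "pt s \<in> C" "pt t \<in> C" using st unfolding xyz(1) abc by blast+
      have "pt s \<noteq> pt t \<and> closed_segment (pt s) (pt t) = closed_segment (pt s) (pt t)"
        using False by simp
      then have "closed_segment (pt s) (pt t) edge_of P"
        unfolding C(3) edge_of_triangle[of x y z, folded xyz(1), OF C(1) \<open>card C = 3\<close>]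
        by (intro bexI[OF _ mem(1)] bexI[OF _ mem(2)])
      then have "vertical (closed_segment (pt s) (pt t)) \<or> nonneg_slope (closed_segment (pt s) (pt t))"
        using bi P unfolding bimonotone_def bimonotone_polygon_def by blast
      then show ?thesis by (rule monotone_segment_chain)
    qed simp
    have "\<exists>p q r. p \<le> q \<and> q \<le> r \<and> {p, q, r} = {a, b, c}"
      by (rule sort_three; rule comp; simp)
    then obtain p q r where pqr: "p \<le> q" "q \<le> r" "{p, q, r} = {a, b, c}"
      by (elim exE conjE)
    define u v where "u = q - p" and "v = r - q"
    have uv: "q = p + u" "r = p + u + v" by (simp_all add: u_def v_def)
    have Cp: "C = {pt p, pt (p + u), pt (p + u + v)}"
    proof -
      have "C = pt ` {a, b, c}" using xyz abc by simp
      also have "\<dots> = pt ` {p, q, r}" using pqr(3) by simp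
      finally show ?thesis using uv by simp
    qed
    have Pt: "P = tri p u v" unfolding C(3) Cp tri_def ..
    have D: "det2 u v \<noteq> 0"
      using affine_independent_chain[of p u v, folded Cp] C(1) \<open>card C = 3\<close> by blast
    have "\<bar>det2 u v\<bar> = 1"
    proof (rule empty_triangle_unimodular[OF D])
      fix w assume "pt w \<in> tri p u v"
      then have "pt w \<in> C" using lattice[OF P] unfolding VC[symmetric] Pt[symmetric] by blast
      then show "w \<in> {p, p + u, p + u + v}" unfolding Cp by simp
    qed
    moreover have "0 \<le> u" "0 \<le> v" using pqr by (auto simp: u_def v_def less_eq_prod_def)
    ultimately have "chain_basis u v" by (simp add: chain_basis_def)
    then show ?thesis using Pt by blast
  qed
  \<comment> \<open>A nonempty intersection is a vertex or a side of \<open>P\<close>, thus a proper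
    face, and proper faces avoid the interior.\<close>
  moreover have "interior P \<inter> interior Q = {}" if PQ: "P \<in> T" "Q \<in> T" "P \<noteq> Q" for P Q
  proof -
    have sub: "interior P \<inter> interior Q \<subseteq> P \<inter> Q" using interior_subset by blast
    from meet[OF PQ] show ?thesis
    proof (elim disjE exE conjE)
      fix v assume v: "v \<in> vertices P" "P \<inter> Q = {v}"
      then have "v \<notin> interior P" using extreme_point_not_in_interior unfolding vertices_def by blast
      then show ?thesis using sub unfolding v(2) by blast
    next
      fix e assume e: "e edge_of P" "P \<inter> Q = e"
      have "aff_dim P = 2" using simp[OF PQ(1)] aff_dim_simplex by blast
      then have "e \<noteq> P" using e(1) unfolding edge_of_def by force
      then have "e \<inter> interior P = {}" using e(1) face_of_disjoint_interior unfolding edge_of_def by blast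
      then show ?thesis using sub unfolding e(2) by blast
    qed (use sub in blast)
  qed
  ultimately show ?thesis unfolding tiling_def using un by blast
qed

subsection \<open>Flipping a parallelogram\<close>

text \<open>On vectors with nonnegative entries this is the 1-norm; being linear, it adds up along
  chains.\<close>

definition height :: "int \<times> int \<Rightarrow> int" where
  "height w = fst w + snd w"

text \<open>The extent of the set in direction (1,1), read off from the points because a tile
  carries no chosen \<open>p\<close>, \<open>u\<close>, \<open>v\<close>. For tiles it is an
  integer, so the floor changes nothing.\<close>

definition chain_length :: "point set \<Rightarrow> nat" where
  "chain_length P = nat \<lfloor>Sup ((\<lambda>x. fst x + snd x) ` P) - Inf ((\<lambda>x. fst x + snd x) ` P)\<rfloor>"

lemma height_add: "height (u + v) = height u + height v"
  by (simp add: height_def)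

lemma height_pos:
  assumes "0 \<le> u" "u \<noteq> 0"
  shows "height u \<ge> 1"
proof -
  obtain a b where "u = (a, b)" by (metis surj_pair)
  then show ?thesis using assms by (auto simp: height_def less_eq_prod_def zero_prod_def)
qed

lemma chain_basis_nonzero:
  assumes "chain_basis u v"
  shows "u \<noteq> 0" "v \<noteq> 0"
  using assms by (auto simp: chain_basis_def det2_def)

lemma chain_basis_height:
  assumes "chain_basis u v"
  shows "height u \<ge> 1" "height v \<ge> 1"
  using assms chain_basis_nonzero[OF assms] height_pos by (auto simp: chain_basis_def)

lemma chain_basis_commute: "chain_basis u v \<Longrightarrow> chain_basis v u"
  by (simp add: chain_basis_def det2_def abs_minus_commute mult.commute)

lemma chain_basis_reduce:
  assumes "chain_basis (v + z) v" "0 \<le> z"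
  shows "chain_basis z v"
  using assms by (simp add: chain_basis_def det2_def algebra_simps)

lemma chain_length_tri:
  assumes "chain_basis u v"
  shows "chain_length (tri p u v) = nat (height (u + v))"
proof -
  let ?f = "\<lambda>x::point. fst x + snd x"
  have uv: "0 \<le> real_of_int (height u)" "0 \<le> real_of_int (height v)"
    using chain_basis_height[OF assms] by simp_all
  have f: "fst (comb p u v s t) + snd (comb p u v s t) = height p + s * height u + t * height v" for s t :: real
    by (simp add: comb_def pt_def height_def algebra_simps)
  have bounds: "height p \<le> ?f x \<and> ?f x \<le> height p + height u + height v" if x: "x \<in> tri p u v" for x
  proof -
    obtain s t where st: "0 \<le> t" "t \<le> s" "s \<le> 1" "x = comb p u v s t" using x[unfolded mem_tri] by (elim exE conjE)
    have "0 \<le> s" "t \<le> 1" using st(1-3) by linarith+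
    then have "0 \<le> s * real_of_int (height u)" "0 \<le> t * real_of_int (height v)"
      "s * real_of_int (height u) \<le> height u" "t * real_of_int (height v) \<le> height v"
      using st(1,3) uv by (simp_all only: mult_nonneg_nonneg mult_left_le_one_le)
    then show ?thesis using f[of s t] unfolding st(4) of_int_add by linarith
  qed
  have ends: "pt p \<in> tri p u v" "pt (p + u + v) \<in> tri p u v"
    unfolding tri_def by (simp_all add: hull_inc)
  have "Sup (?f ` tri p u v) = height p + height u + height v"
  proof (rule cSup_eq_maximum)
    show "real_of_int (height p + height u + height v) \<in> ?f ` tri p u v"
      by (rule image_eqI[OF _ ends(2)]) (simp add: pt_def height_def)
    fix y assume "y \<in> ?f ` tri p u v"
    then show "y \<le> real_of_int (height p + height u + height v)"
      using bounds by (elim imageE) simp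
  qed
  moreover have "Inf (?f ` tri p u v) = height p"
  proof (rule cInf_eq_minimum)
    show "real_of_int (height p) \<in> ?f ` tri p u v"
      by (rule image_eqI[OF _ ends(1)]) (simp add: pt_def height_def)
    fix y assume "y \<in> ?f ` tri p u v"
    then show "real_of_int (height p) \<le> y"
      using bounds by (elim imageE) simp
  qed
  ultimately have "Sup (?f ` tri p u v) - Inf (?f ` tri p u v) = real_of_int (height (u + v))"
    by (simp add: height_add)
  then show ?thesis unfolding chain_length_def by (simp only: floor_of_int)
qed

text \<open>Both sides are the parallelogram spanned at \<open>p\<close> by \<open>v + z\<close> and
  \<open>v\<close>, in whose coordinates it is the unit square, cut along
  \<open>\<alpha> = \<beta>\<close> on the left and along \<open>\<alpha> + \<beta> = 1\<close> on
  the right. The difference \<open>z\<close> of the two steps is the direction of the new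
  diagonal.\<close>

lemma parallelogram_triangulations:
  "tri p (v + z) v \<union> tri p v (v + z) = tri p v z \<union> tri (p + v) z v"
proof -
  let ?c = "comb p (v + z) v"
  have c: "comb p v (v + z) s t = ?c t s" "comb p v z s t = ?c t (s - t)"
    "comb (p + v) z v s t = ?c s (1 + t - s)" for s t
    by (simp_all add: comb_def pt_add algebra_simps)
  have "x \<in> tri p (v + z) v \<union> tri p v (v + z) \<longleftrightarrow>
      (\<exists>\<alpha> \<beta>. 0 \<le> \<alpha> \<and> \<alpha> \<le> 1 \<and> 0 \<le> \<beta> \<and> \<beta> \<le> 1 \<and> x = ?c \<alpha> \<beta>)" (is "?l \<longleftrightarrow> ?r") for x
  proof
    assume ?l
    then show ?r unfolding Un_iff mem_tri c
      by (elim disjE exE conjE) (metis order.trans)+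
  next
    assume ?r
    then obtain \<alpha> \<beta> where ab: "0 \<le> \<alpha>" "\<alpha> \<le> 1" "0 \<le> \<beta>" "\<beta> \<le> 1" "x = ?c \<alpha> \<beta>" by blast
    then show ?l unfolding Un_iff mem_tri c
      by (cases "\<alpha> \<le> \<beta>") (use linear in blast)+
  qed
  moreover have "x \<in> tri p v z \<union> tri (p + v) z v \<longleftrightarrow>
      (\<exists>\<alpha> \<beta>. 0 \<le> \<alpha> \<and> \<alpha> \<le> 1 \<and> 0 \<le> \<beta> \<and> \<beta> \<le> 1 \<and> x = ?c \<alpha> \<beta>)" (is "?l \<longleftrightarrow> ?r") for x
  proof
    assume ?l
    then show ?r unfolding Un_iff mem_tri c
    proof (elim disjE exE conjE)
      fix s t :: real assume "0 \<le> t" "t \<le> s" "s \<le> 1" "x = ?c t (s - t)"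
      then show ?thesis by (intro exI[of _ t] exI[of _ "s - t"]) simp
    next
      fix s t :: real assume "0 \<le> t" "t \<le> s" "s \<le> 1" "x = ?c s (1 + t - s)"
      then show ?thesis by (intro exI[of _ s] exI[of _ "1 + t - s"]) simp
    qed
  next
    assume ?r
    then obtain \<alpha> \<beta> where ab: "0 \<le> \<alpha>" "\<alpha> \<le> 1" "0 \<le> \<beta>" "\<beta> \<le> 1" "x = ?c \<alpha> \<beta>" by blast
    show ?l
    proof (cases "\<alpha> + \<beta> \<le> 1")
      case True
      then have "x \<in> tri p v z" unfolding mem_tri c using ab
        by (intro exI[of _ "\<alpha> + \<beta>"] exI[of _ \<alpha>]) simp
      then show ?thesis ..
    next
      case False
      then have "x \<in> tri (p + v) z v" unfolding mem_tri c using ab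
        by (intro exI[of _ \<alpha>] exI[of _ "\<alpha> + \<beta> - 1"]) simp
      then show ?thesis ..
    qed
  qed
  ultimately show ?thesis by blast
qed

text \<open>In the coordinates of the parallelogram the coordinate sum is below 1 inside the first
  triangle and above 1 inside the second.\<close>

lemma parallelogram_interiors:
  assumes "chain_basis (v + z) v" "0 \<le> z"
  shows "interior (tri p v z) \<inter> interior (tri (p + v) z v) = {}"
proof -
  let ?c = "comb p (v + z) v"
  have c: "comb p v z s t = ?c t (s - t)" "comb (p + v) z v s t = ?c s (1 + t - s)" for s t
    by (simp_all add: comb_def pt_add algebra_simps)
  have zv: "chain_basis z v" using chain_basis_reduce[OF assms] .
  have False if x: "x \<in> interior (tri p v z)" "x \<in> interior (tri (p + v) z v)" for x
  proof -
    obtain s t where 1: "0 < t" "t < s" "s < 1" "x = ?c t (s - t)"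
      using x(1) unfolding interior_tri[OF chain_basis_commute[OF zv]] c by blast
    obtain s' t' where 2: "0 < t'" "t' < s'" "s' < 1" "x = ?c s' (1 + t' - s')"
      using x(2) unfolding interior_tri[OF zv] c by blast
    have "t = s'" "s - t = 1 + t' - s'"
      using 1(4) 2(4) unfolding comb_coords[OF assms(1)] by simp_all
    then show False using 1 2 by linarith
  qed
  then show ?thesis by blast
qed

text \<open>What \<open>A\<close> leaves of \<open>U\<close> is an open part of \<open>B\<close>,
  hence empty; so \<open>U\<close> is an open part of \<open>A\<close> and empty too. This keeps the
  new triangles clear of the remaining tiles.\<close>

lemma open_subset_Un_closed:
  assumes "open U" "U \<subseteq> A \<union> B" "closed A" "U \<inter> interior A = {}" "U \<inter> interior B = {}"
  shows "U = {}"
proof -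
  have "U - A \<subseteq> interior B"
    using assms by (intro interior_maximal) (auto intro: open_Diff)
  then have "U \<subseteq> A" using assms(5) by blast
  then have "U \<subseteq> interior A" using assms(1) by (rule interior_maximal)
  then show ?thesis using assms(4) by blast
qed

section \<open>The quadrilateral of a flip\<close>

lemma not_in_convex_hull:
  fixes x :: "'a::euclidean_space"
  assumes "\<And>y. y \<in> S \<Longrightarrow> w \<bullet> y \<le> k" "w \<bullet> x > k"
  shows "x \<notin> convex hull S"
proof -
  have "convex hull S \<subseteq> {y. w \<bullet> y \<le> k}"
    using assms(1) by (intro hull_minimal convex_halfspace_le) auto
  then show ?thesis using assms(2) by auto
qed

text \<open>The diagonals share their midpoint. If the segment from \<open>a\<close> to
  \<open>c\<close> were a face of \<open>Q\<close>, this interior point of the segment from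
  \<open>b\<close> to \<open>d\<close> would pull \<open>b\<close> into it.\<close>

lemma diagonal_not_edge:
  fixes a b c d :: "'a::euclidean_space"
  assumes sum: "a + c = b + d" and b: "b \<notin> convex hull {a, c, d}" and Q: "b \<in> Q" "d \<in> Q" "b \<noteq> d"
  shows "\<not> closed_segment a c edge_of Q"
proof
  assume "closed_segment a c edge_of Q"
  then have face: "closed_segment a c face_of Q" by (simp add: edge_of_def)
  have "midpoint a c = midpoint b d" using sum by (simp add: midpoint_def)
  then have "midpoint b d \<in> closed_segment a c" by (metis midpoint_in_closed_segment)
  moreover have "midpoint b d \<in> open_segment b d" using Q(3) by simp
  ultimately have "b \<in> closed_segment a c" using face Q unfolding face_of_def by blast
  then have "b \<in> convex hull {a, c}" by (simp add: segment_convex_hull)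
  then show False using b hull_mono[of "{a, c}" "{a, c, d}"] by blast
qed

lemma parallelogram_quadrilateral:
  fixes p u v :: "int \<times> int"
  assumes uv: "chain_basis u v"
  defines "a \<equiv> pt p" and "b \<equiv> pt (p + u)" and "c \<equiv> pt (p + u + v)" and "d \<equiv> pt (p + v)"
  defines "Q \<equiv> convex hull {a, b, c, d}"
  shows "convex_polygon Q" "vertices Q = {a, b, c, d}" "card {a, b, c, d} = 4"
    "diagonal Q a c" "diagonal Q b d"
proof -
  define \<delta> where "\<delta> = real_of_int (det2 u v)"
  have \<delta>: "\<delta> * (real_of_int (fst u) * snd v - real_of_int (snd u) * fst v) = 1"
    by (rule chain_basis_cases[OF uv])
      (simp_all add: \<delta>_def det2_def flip: of_int_mult of_int_diff)
  \<comment> \<open>The dual basis of \<open>u\<close> and \<open>v\<close>. It turns the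
    quadrilateral into a unit square, whose corners are cut off by \<open>f + g\<close>,
    \<open>f - g\<close> and their negatives.\<close>
  define f g :: point where "f = (\<delta> * snd v, - \<delta> * fst v)" and "g = (- \<delta> * snd u, \<delta> * fst u)"
  have fg: "f \<bullet> pt u = 1" "f \<bullet> pt v = 0" "g \<bullet> pt u = 0" "g \<bullet> pt v = 1"
    using \<delta> by (simp_all add: f_def g_def pt_def algebra_simps)
  have val: "f \<bullet> b = f \<bullet> a + 1" "f \<bullet> c = f \<bullet> a + 1" "f \<bullet> d = f \<bullet> a"
    "g \<bullet> b = g \<bullet> a" "g \<bullet> c = g \<bullet> a + 1" "g \<bullet> d = g \<bullet> a + 1"
    by (simp_all add: a_def b_def c_def d_def pt_add inner_add_right fg)
  have na: "a \<notin> convex hull {b, c, d}"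
    by (rule not_in_convex_hull[where w = "- (f + g)" and k = "- (f + g) \<bullet> a - 1"])
      ((elim insertE emptyE)?; simp add: inner_diff_left inner_add_left inner_minus_left val)+
  have nb: "b \<notin> convex hull {a, c, d}"
    by (rule not_in_convex_hull[where w = "f - g" and k = "(f - g) \<bullet> a"])
      ((elim insertE emptyE)?; simp add: inner_diff_left inner_add_left inner_minus_left val)+
  have nc: "c \<notin> convex hull {a, b, d}"
    by (rule not_in_convex_hull[where w = "f + g" and k = "(f + g) \<bullet> a + 1"])
      ((elim insertE emptyE)?; simp add: inner_diff_left inner_add_left inner_minus_left val)+
  have nd: "d \<notin> convex hull {a, b, c}"
    by (rule not_in_convex_hull[where w = "g - f" and k = "(g - f) \<bullet> a"])
      ((elim insertE emptyE)?; simp add: inner_diff_left inner_add_left inner_minus_left val)+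
  have ne: "a \<noteq> b" "a \<noteq> c" "a \<noteq> d" "b \<noteq> c" "b \<noteq> d" "c \<noteq> d"
    using val by auto
  then show "card {a, b, c, d} = 4" by simp
  have rot: "{a, b, c, d} = insert b {a, c, d}" "{a, b, c, d} = insert c {a, b, d}" "{a, b, c, d} = insert d {a, b, c}"
    by blast+
  have "a extreme_point_of Q" unfolding Q_def by (rule extreme_point_of_convex_hull_insert) (use na in simp_all)
  moreover have "b extreme_point_of Q" unfolding Q_def rot(1) by (rule extreme_point_of_convex_hull_insert) (use nb in simp_all)
  moreover have "c extreme_point_of Q" unfolding Q_def rot(2) by (rule extreme_point_of_convex_hull_insert) (use nc in simp_all)
  moreover have "d extreme_point_of Q" unfolding Q_def rot(3) by (rule extreme_point_of_convex_hull_insert) (use nd in simp_all)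
  ultimately show V: "vertices Q = {a, b, c, d}"
    using extreme_point_of_convex_hull[of _ "{a, b, c, d}"] unfolding vertices_def Q_def by blast
  have "tri p u v \<subseteq> Q" unfolding tri_def Q_def a_def b_def c_def by (rule hull_mono) blast
  then have "interior Q \<noteq> {}" using interior_tri_nonempty[OF uv, of p] interior_mono by blast
  then show "convex_polygon Q" unfolding convex_polygon_def Q_def by (simp add: polytope_convex_hull)
  have inQ: "a \<in> Q" "b \<in> Q" "c \<in> Q" "d \<in> Q" unfolding Q_def by (simp_all add: hull_inc)
  have sum: "a + c = b + d" by (simp add: a_def b_def c_def d_def pt_add)
  have "\<not> closed_segment a c edge_of Q"
    by (rule diagonal_not_edge[OF sum nb]) (use inQ ne in simp_all)
  then show "diagonal Q a c" using ne by (simp add: diagonal_def V)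
  have "a \<notin> convex hull {b, d, c}" using na by (simp add: insert_commute)
  then have "\<not> closed_segment b d edge_of Q"
    by (rule diagonal_not_edge[OF sum[symmetric]]) (use inQ ne in simp_all)
  then show "diagonal Q b d" using ne by (simp add: diagonal_def V)
qed

lemma flip_parallelogram:
  assumes T: "tiling R T" and uv: "chain_basis (v + z) v" "0 \<le> z"
    and P: "tri p (v + z) v \<in> T" "tri p v (v + z) \<in> T"
  defines "T' \<equiv> (T - {tri p (v + z) v, tri p v (v + z)}) \<union> {tri p v z, tri (p + v) z v}"
  shows "tiling R T'" "flip T T'" "flip T' T"
proof -
  let ?P1 = "tri p (v + z) v" and ?P2 = "tri p v (v + z)" and ?P3 = "tri p v z" and ?P4 = "tri (p + v) z v"
  have cb: "chain_basis v (v + z)" "chain_basis z v" "chain_basis v z"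
    using chain_basis_commute chain_basis_reduce uv by blast+
  have un: "?P1 \<union> ?P2 = ?P3 \<union> ?P4" by (rule parallelogram_triangulations)
  have disjT: "interior S \<inter> interior S' = {}" if "S \<in> T" "S' \<in> T" "S \<noteq> S'" for S S'
    using T that by (simp add: tiling_def)
  have disj: "interior S \<inter> interior N = {}"
    if S: "S \<in> T" "S \<noteq> ?P1" "S \<noteq> ?P2" and N: "N = ?P3 \<or> N = ?P4" for S N
  proof (rule open_subset_Un_closed)
    show "interior S \<inter> interior N \<subseteq> ?P1 \<union> ?P2"
      using un N interior_subset by blast
    show "interior S \<inter> interior N \<inter> interior ?P1 = {}" using disjT[OF S(1) P(1) S(2)] by blast
    show "interior S \<inter> interior N \<inter> interior ?P2 = {}" using disjT[OF S(1) P(2) S(3)] by blast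
  qed (auto simp: compact_tri compact_imp_closed)
  \<comment> \<open>Triangulations are sets, so undoing the flip recovers \<open>T\<close> only if
    the new triangles are not already among the remaining tiles. Such a tile would have an interior
    disjoint from itself.\<close>
  have new: "N \<notin> T - {?P1, ?P2}" if N: "N = ?P3 \<or> N = ?P4" for N
  proof
    assume "N \<in> T - {?P1, ?P2}"
    then have "N \<in> T" "N \<noteq> ?P1" "N \<noteq> ?P2" by simp_all
    then have "interior N \<inter> interior N = {}" using N by (rule disj)
    moreover have "interior N \<noteq> {}"
      using N interior_tri_nonempty[OF cb(3), of p] interior_tri_nonempty[OF cb(2), of "p + v"]
      by (elim disjE) simp_all
    ultimately show False by simp
  qed
  have new_cases: "S \<in> T - {?P1, ?P2} \<or> S = ?P3 \<or> S = ?P4" if S: "S \<in> T'" for S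
    using S unfolding T'_def by blast
  have restore: "(T - {?P1, ?P2}) \<union> {?P1, ?P2} = T" using P by blast
  show "tiling R T'"
    unfolding tiling_def
  proof (intro conjI ballI impI)
    fix S assume "S \<in> T'"
    from new_cases[OF this] show "\<exists>p u v. chain_basis u v \<and> S = tri p u v"
    proof (elim disjE)
      assume "S \<in> T - {?P1, ?P2}"
      then show ?thesis using T by (simp add: tiling_def)
    next
      assume "S = ?P3"
      with cb(3) show ?thesis by (intro exI conjI)
    next
      assume "S = ?P4"
      with cb(2) show ?thesis by (intro exI conjI)
    qed
  next
    have "\<Union>T' = \<Union>(T - {?P1, ?P2}) \<union> (?P1 \<union> ?P2)"
      unfolding un T'_def by (simp only: Union_Un_distrib Union_insert Union_empty Un_empty_right)
    also have "\<dots> = \<Union>((T - {?P1, ?P2}) \<union> {?P1, ?P2})"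
      by (simp only: Union_Un_distrib Union_insert Union_empty Un_empty_right)
    finally show "\<Union>T' = R" using T unfolding restore by (simp add: tiling_def)
  next
    fix S S' assume SS: "S \<in> T'" "S' \<in> T'" "S \<noteq> S'"
    have *: "interior ?P3 \<inter> interior ?P4 = {}" by (rule parallelogram_interiors[OF uv])
    show "interior S \<inter> interior S' = {}"
    proof (cases "S \<in> T - {?P1, ?P2}"; cases "S' \<in> T - {?P1, ?P2}")
      assume "S \<in> T - {?P1, ?P2}" "S' \<in> T - {?P1, ?P2}"
      then show ?thesis using disjT[of S S'] SS(3) by simp
    next
      assume S: "S \<in> T - {?P1, ?P2}" "S' \<notin> T - {?P1, ?P2}"
      have "S' = ?P3 \<or> S' = ?P4" using new_cases[OF SS(2)] S(2) by argo
      with S(1) show ?thesis by (intro disj) simp_all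
    next
      assume S: "S \<notin> T - {?P1, ?P2}" "S' \<in> T - {?P1, ?P2}"
      have "S = ?P3 \<or> S = ?P4" using new_cases[OF SS(1)] S(1) by argo
      with S(2) have "interior S' \<inter> interior S = {}" by (intro disj) simp_all
      then show ?thesis by (simp add: Int_commute)
    next
      assume S: "S \<notin> T - {?P1, ?P2}" "S' \<notin> T - {?P1, ?P2}"
      then have "S = ?P3 \<or> S = ?P4" "S' = ?P3 \<or> S' = ?P4"
        using new_cases[OF SS(1)] new_cases[OF SS(2)] by argo+
      then show ?thesis using * SS(3) by (elim disjE) (simp_all add: Int_commute)
    qed
  qed
  let ?a = "pt p" and ?b = "pt (p + (v + z))" and ?c = "pt (p + (v + z) + v)" and ?d = "pt (p + v)"
  have t1: "convex hull {?a, ?b, ?c} = ?P1" by (simp add: tri_def)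
  have t2: "convex hull {?a, ?c, ?d} = ?P2" by (simp only: tri_def ac_simps insert_commute)
  have t3: "convex hull {?a, ?b, ?d} = ?P3" by (simp only: tri_def ac_simps insert_commute)
  have t4: "convex hull {?b, ?c, ?d} = ?P4" by (simp only: tri_def ac_simps insert_commute)
  note quad = parallelogram_quadrilateral[OF uv(1), of p]
  show "flip T T'"
    unfolding flip_def
    by (rule exI[of _ "convex hull {?a, ?b, ?c, ?d}"], rule exI[of _ ?a], rule exI[of _ ?b],
        rule exI[of _ ?c], rule exI[of _ ?d], unfold t1 t2 t3 t4)
      (intro conjI quad P, simp add: T'_def)
  \<comment> \<open>The reverse flip uses the same quadrilateral with its vertices renamed
    cyclically, which exchanges the two diagonals.\<close>
  have rot: "{?b, ?c, ?d, ?a} = {?a, ?b, ?c, ?d}" by blast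
  have sym: "diagonal Q x y" if "diagonal Q y x" for Q x y
    using that unfolding diagonal_def by (subst closed_segment_commute) blast
  have r1: "convex hull {?b, ?c, ?d} = ?P4" "convex hull {?b, ?d, ?a} = ?P3"
    "convex hull {?b, ?c, ?a} = ?P1" "convex hull {?c, ?d, ?a} = ?P2"
    using t1 t2 t3 t4 by (simp_all only: insert_commute)
  have n: "?P3 \<notin> T - {?P1, ?P2}" "?P4 \<notin> T - {?P1, ?P2}" by (rule new, simp)+
  have "X \<union> {A, B} - {B, A} = X" if "A \<notin> X" "B \<notin> X" for X :: "point set set" and A B
    using that by blast
  from this[OF n] have "T' - {?P4, ?P3} = T - {?P1, ?P2}"
    unfolding T'_def .
  then have T_eq: "T = (T' - {?P4, ?P3}) \<union> {?P1, ?P2}"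
    by (simp only: restore)
  have new_mem: "?P4 \<in> T'" "?P3 \<in> T'" by (simp_all add: T'_def)
  show "flip T' T"
    unfolding flip_def
    by (rule exI[of _ "convex hull {?a, ?b, ?c, ?d}"], rule exI[of _ ?b], rule exI[of _ ?c],
        rule exI[of _ ?d], rule exI[of _ ?a], unfold r1 rot)
      (intro conjI quad sym[OF quad(4)] new_mem T_eq)
qed

subsection \<open>The neighbour across a long edge\<close>

lemma finite_tiling:
  assumes mn: "m \<ge> 1" "n \<ge> 1" and T: "tiling (convex hull lattice_grid m n) T"
  shows "finite T"
proof (rule finite_subset)
  show "T \<subseteq> (\<lambda>S. convex hull S) ` Pow (lattice_grid m n)"
  proof
    fix P assume P: "P \<in> T"
    from tiling_imp_full[OF mn T] have V: "vertices P \<subseteq> lattice_grid m n"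
      using P by (simp add: full_bimonotone_triangulation_def triangulation_def subdivision_def)
    from T P have "\<exists>p u v. chain_basis u v \<and> P = tri p u v" by (simp add: tiling_def)
    then obtain p u v where t: "chain_basis u v" "P = tri p u v" by (elim exE conjE)
    have "P = convex hull vertices P" unfolding t(2) vertices_tri[OF t(1)] by (simp add: tri_def)
    then show "P \<in> (\<lambda>S. convex hull S) ` Pow (lattice_grid m n)" using V by (intro image_eqI PowI)
  qed
  show "finite ((\<lambda>S. convex hull S) ` Pow (lattice_grid m n))"
    using finite_lattice_grid by simp
qed

section \<open>Unimodular splittings of a primitive vector\<close>

lemma parallel_multiple:
  assumes "\<bar>det2 u w\<bar> = 1" "det2 x w = 0"
  obtains t where "fst x = t * fst w" "snd x = t * snd w"
proof -
  define e where "e = det2 u w"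
  have e: "e * e = 1" using assms(1) by (cases "e \<ge> 0") (auto simp: e_def)
  \<comment> \<open>Cramer's rule expands \<open>x\<close> in the basis \<open>u\<close>,
    \<open>w\<close>; as \<open>e * e = 1\<close>, the coefficient of \<open>w\<close> is an
    integer.\<close>
  have "e * fst x = det2 x w * fst u + det2 u x * fst w" "e * snd x = det2 x w * snd u + det2 u x * snd w"
    by (simp_all add: e_def det2_def algebra_simps)
  then have "e * (e * fst x) = e * det2 u x * fst w" "e * (e * snd x) = e * det2 u x * snd w"
    using assms(2) by simp_all
  then have "fst x = e * det2 u x * fst w" "snd x = e * det2 u x * snd w"
    by (simp_all add: e flip: mult.assoc)
  then show ?thesis by (rule that)
qed

text \<open>Both \<open>u\<close> and \<open>u'\<close> lie in the box between 0 and
  \<open>w = u + v\<close> and have determinant 1 or -1 with \<open>w\<close>. Equal signs make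
  \<open>u' - u\<close> an integer multiple of \<open>w\<close>, opposite signs make
  \<open>u + u'\<close> one. Inside the box, with the corners 0 and \<open>w\<close> excluded, the
  factor can only be 0 in the first case and 1 in the second.\<close>

lemma chain_basis_same_sum:
  assumes cb: "chain_basis u v" "chain_basis u' v'" and eq: "u + v = u' + v'"
  shows "u' = u \<and> v' = v \<or> u' = v \<and> v' = u"
proof -
  define w where "w = u + v"
  have v: "v = w - u" "v' = w - u'" using eq by (simp_all add: w_def algebra_simps)
  have b: "0 \<le> fst u" "0 \<le> snd u" "fst u \<le> fst w" "snd u \<le> snd w"
    "0 \<le> fst u'" "0 \<le> snd u'" "fst u' \<le> fst w" "snd u' \<le> snd w"
    using cb unfolding v chain_basis_def less_eq_prod_def by simp_all
  then have w0: "0 \<le> fst w" "0 \<le> snd w" by linarith+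
  have nz: "u \<noteq> 0" "u' \<noteq> 0" "u \<noteq> w" "u' \<noteq> w"
    using chain_basis_nonzero[OF cb(1)] chain_basis_nonzero[OF cb(2)] unfolding v by simp_all
  have zeroI: "x = 0" if "fst x = 0" "snd x = 0" for x :: "int \<times> int"
    using that by (simp add: prod_eq_iff)
  have det: "det2 u v = det2 u w" "det2 u' v' = det2 u' w"
    unfolding v by (simp_all add: det2_def algebra_simps)
  have scale: "fst w \<le> t * fst w" "snd w \<le> t * snd w" if "t \<ge> 1" for t
    using mult_right_mono[OF that w0(1)] mult_right_mono[OF that w0(2)] by simp_all
  have abs: "\<bar>det2 u w\<bar> = 1" "\<bar>det2 u' w\<bar> = 1" using cb det by (simp_all add: chain_basis_def)
  then consider "det2 u' w = det2 u w" | "det2 u' w = - det2 u w" by linarith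
  then show ?thesis
  proof cases
    case 1
    then have "det2 (u' - u) w = 0" by (simp add: det2_def algebra_simps)
    with abs(1) obtain t where t: "fst (u' - u) = t * fst w" "snd (u' - u) = t * snd w"
      by (rule parallel_multiple)
    have "\<not> t \<ge> 1"
    proof
      assume "t \<ge> 1"
      from scale[OF this] t b have "fst u = 0" "snd u = 0" by simp_all
      then show False using nz zeroI by blast
    qed
    moreover have "\<not> - t \<ge> 1"
    proof
      assume "- t \<ge> 1"
      from scale[OF this] t b have "fst u' = 0" "snd u' = 0" by simp_all
      then show False using nz zeroI by blast
    qed
    ultimately have "t = 0" by linarith
    then have "u' = u" using t by (simp add: prod_eq_iff)
    then show ?thesis using v by simp
  next
    case 2
    then have "det2 (u + u') w = 0" by (simp add: det2_def algebra_simps)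
    with abs(1) obtain t where t: "fst (u + u') = t * fst w" "snd (u + u') = t * snd w"
      by (rule parallel_multiple)
    have "\<not> 1 - t \<ge> 1"
    proof
      assume "1 - t \<ge> 1"
      from scale[OF this] have "t * fst w \<le> 0" "t * snd w \<le> 0" by (simp_all add: algebra_simps)
      then have "fst u = 0" "snd u = 0" using t b by simp_all
      then show False using nz zeroI by blast
    qed
    moreover have "\<not> t - 1 \<ge> 1"
    proof
      assume "t - 1 \<ge> 1"
      from scale[OF this] have "2 * fst w \<le> t * fst w" "2 * snd w \<le> t * snd w"
        by (simp_all add: algebra_simps)
      then have "fst u = fst w" "snd u = snd w" using t b by simp_all
      then show False using nz by (simp add: prod_eq_iff)
    qed
    ultimately have "t = 1" by linarith
    then have "u' = w - u" using t by (simp add: prod_eq_iff)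
    then show ?thesis using v by simp
  qed
qed

lemma comb_inj:
  assumes "chain_basis u v" "comb p u v s t = comb p u v s' t'"
  shows "s = s'" "t = t'"
  using comb_coords[OF assms(1), of "comb p u v s t" p s t]
    comb_coords[OF assms(1), of "comb p u v s t" p s' t'] assms(2) by simp_all

lemma comb_swap: "comb p v u s t = comb p u v t s"
  by (simp add: comb_def)

text \<open>In coordinates the corners are (0,0), (1,0), (1,1), and (1/2,1/2) lies only on the side
  joining the first to the last. Allowing \<open>i = j\<close> covers triangles that meet in a
  single vertex.\<close>

lemma midpoint_of_long_edge:
  assumes cb: "chain_basis u v" and ij: "i \<in> {p, p + u, p + u + v}" "j \<in> {p, p + u, p + u + v}"
    and c: "comb p u v (1/2) (1/2) \<in> closed_segment (pt i) (pt j)"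
  shows "i = p \<and> j = p + u + v \<or> i = p + u + v \<and> j = p"
proof -
  have corner: "\<exists>s t. pt z = comb p u v s t \<and> (s = 0 \<and> t = 0 \<and> z = p \<or> s = 1 \<and> t = 0 \<or> s = 1 \<and> t = 1 \<and> z = p + u + v)"
    if z: "z \<in> {p, p + u, p + u + v}" for z
    using z
  proof (elim insertE emptyE)
    assume "z = p"
    then show ?thesis by (intro exI[of _ 0] exI[of _ 0]) (simp add: comb_def)
  next
    assume "z = p + u"
    then show ?thesis by (intro exI[of _ 1] exI[of _ 0]) (simp add: comb_def pt_add)
  next
    assume "z = p + u + v"
    then show ?thesis by (intro exI[of _ 1] exI[of _ 1]) (simp add: comb_def pt_add)
  qed
  from corner[OF ij(1)] obtain s t where st: "pt i = comb p u v s t"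
    "s = 0 \<and> t = 0 \<and> i = p \<or> s = 1 \<and> t = 0 \<or> s = 1 \<and> t = 1 \<and> i = p + u + v"
    by (elim exE conjE)
  from corner[OF ij(2)] obtain s' t' where st': "pt j = comb p u v s' t'"
    "s' = 0 \<and> t' = 0 \<and> j = p \<or> s' = 1 \<and> t' = 0 \<or> s' = 1 \<and> t' = 1 \<and> j = p + u + v"
    by (elim exE conjE)
  from c have "\<exists>k. comb p u v (1/2) (1/2) = (1 - k) *\<^sub>R pt i + k *\<^sub>R pt j"
    by (auto simp: closed_segment_def)
  then obtain k where "comb p u v (1/2) (1/2) = (1 - k) *\<^sub>R pt i + k *\<^sub>R pt j" ..
  also have "\<dots> = comb p u v ((1 - k) * s + k * s') ((1 - k) * t + k * t')"
    unfolding st(1) st'(1) by (simp add: comb_def algebra_simps)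
  finally have "1/2 = (1 - k) * s + k * s'" "1/2 = (1 - k) * t + k * t'"
    by (rule comb_inj[OF cb])+
  with st(2) st'(2) show ?thesis
    by (elim disjE conjE) simp_all
qed

text \<open>Points just across the midpoint of the long edge converge to it, so some other triangle
  contains this midpoint; being face-to-face with the given one, it has the long edge as a side,
  and by maximality this is its long edge, too.\<close>

lemma neighbour_across_long_edge:
  assumes T: "tiling R T" "finite T" and cb: "chain_basis u v" and P: "tri p u v \<in> T"
    and sub: "tri p v u \<subseteq> R"
    and max: "\<And>p' u' v'. chain_basis u' v' \<Longrightarrow> tri p' u' v' \<in> T \<Longrightarrow> height (u' + v') \<le> height (u + v)"
  shows "tri p v u \<in> T"
proof -
  define c where "c = comb p u v (1/2) (1/2)"
  \<comment> \<open>The factor 1/4 bounds the offset, so that all points \<open>x k\<close> stay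
    inside the swapped triangle.\<close>
  define e :: "nat \<Rightarrow> real" where "e k = inverse (real (Suc k)) / 4" for k
  define x where "x k = comb p u v (1/2 - e k) (1/2 + e k)" for k
  have e: "0 < e k" "e k \<le> 1/4" for k
    by (simp_all add: e_def divide_simps)
  have "(\<lambda>k. e k) \<longlonglongrightarrow> 0 / 4"
    unfolding e_def by (intro tendsto_divide LIMSEQ_inverse_real_of_nat tendsto_const) simp
  then have e0: "e \<longlonglongrightarrow> 0" by simp
  have "(\<lambda>k. comb p u v (1/2 - e k) (1/2 + e k)) \<longlonglongrightarrow> comb p u v (1/2 - 0) (1/2 + 0)"
    unfolding comb_def by (intro tendsto_intros e0)
  then have lim: "x \<longlonglongrightarrow> c" by (simp add: x_def[abs_def] c_def)
  have x_in: "x k \<in> \<Union>(T - {tri p u v})" for k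
  proof -
    have "x k \<in> tri p v u"
      unfolding mem_tri x_def comb_swap[of p v u]
      by (rule exI[of _ "1/2 + e k"], rule exI[of _ "1/2 - e k"]) (use e[of k] in simp)
    then have "x k \<in> \<Union>T" using sub T(1) by (auto simp: tiling_def)
    moreover have "x k \<notin> tri p u v"
    proof
      assume "x k \<in> tri p u v"
      then obtain s t where st: "t \<le> s" "x k = comb p u v s t" unfolding mem_tri by (elim exE conjE)
      have "1/2 - e k = s" "1/2 + e k = t"
        using comb_inj[OF cb st(2)[unfolded x_def]] by simp_all
      then show False using st(1) e(1)[of k] by linarith
    qed
    ultimately show ?thesis by blast
  qed
  have tri: "\<exists>p u v. chain_basis u v \<and> P = tri p u v" if "P \<in> T" for P
    using T(1) that by (simp add: tiling_def)
  have "closed Q" if Q: "Q \<in> T - {tri p u v}" for Q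
  proof -
    from Q have "\<exists>p u v. chain_basis u v \<and> Q = tri p u v" by (intro tri) simp
    then obtain p' u' v' where "Q = tri p' u' v'" by (elim exE conjE)
    then show ?thesis by (simp add: compact_tri compact_imp_closed)
  qed
  then have "closed (\<Union>(T - {tri p u v}))" using T(2) by (intro closed_Union) auto
  from closed_sequentially[OF this _ lim] x_in have "c \<in> \<Union>(T - {tri p u v})" by simp
  then obtain Q where Q: "Q \<in> T" "Q \<noteq> tri p u v" "c \<in> Q" by blast
  from tri[OF Q(1)] obtain p' u' v' where q: "chain_basis u' v'" "Q = tri p' u' v'"
    by (elim exE conjE)
  have cP: "c \<in> tri p u v" unfolding mem_tri c_def
    by (rule exI[of _ "1/2"], rule exI[of _ "1/2"]) simp
  have disj: "interior (tri p u v) \<inter> interior (tri p' u' v') = {}"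
    using T(1) P Q(1,2) unfolding q(2) tiling_def by (simp add: eq_commute)
  have "pt p \<in> Q \<and> pt (p + u + v) \<in> Q"
    using tri_Int[OF cb q(1) disj, folded q(2)]
  proof (elim disjE exE conjE)
    assume "tri p u v \<inter> Q = {}"
    then show ?thesis using cP Q(3) by blast
  next
    fix y assume y: "y \<in> vertices (tri p u v)" "tri p u v \<inter> Q = {y}"
    then have "c = y" using cP Q(3) by blast
    with y(1) obtain z where z: "z \<in> {p, p + u, p + u + v}" "c = pt z"
      unfolding vertices_tri[OF cb] by blast
    then have "c \<in> closed_segment (pt z) (pt z)" by simp
    from midpoint_of_long_edge[OF cb z(1) z(1) this[unfolded c_def]]
    have "z = p \<and> z = p + u + v" by blast
    then have "height (u + v) = 0" by (metis add.assoc add_cancel_left_right height_add)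
    then show ?thesis using chain_basis_height[OF cb] by (simp add: height_add)
  next
    fix f assume f: "f edge_of tri p u v" "tri p u v \<inter> Q = f"
    from f(1) obtain i j where ij: "i \<in> {p, p + u, p + u + v}" "j \<in> {p, p + u, p + u + v}"
      "f = closed_segment (pt i) (pt j)"
      unfolding edge_of_tri[OF cb] vertices_tri[OF cb] by blast
    have "c \<in> f" using cP Q(3) f(2) by blast
    then have "i = p \<and> j = p + u + v \<or> i = p + u + v \<and> j = p"
      using midpoint_of_long_edge[OF cb ij(1,2)] unfolding c_def ij(3) by blast
    moreover have "pt i \<in> f" "pt j \<in> f" unfolding ij(3) by simp_all
    then have "pt i \<in> Q" "pt j \<in> Q" using f(2) by blast+
    ultimately show ?thesis by (elim disjE conjE) simp_all
  qed
  then have ends: "p \<in> {p', p' + u', p' + u' + v'}" "p + u + v \<in> {p', p' + u', p' + u' + v'}"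
    unfolding q(2) using lattice_point_in_tri[OF q(1)] by simp_all
  have h: "height u \<ge> 1" "height v \<ge> 1" "height u' \<ge> 1" "height v' \<ge> 1"
    "height u' + height v' \<le> height u + height v"
    using chain_basis_height[OF cb] chain_basis_height[OF q(1)] max[OF q(1)] Q(1)
    by (simp_all add: q(2) height_add)
  have heights: "z = p' \<and> height z = height p' \<or> z = p' + u' \<and> height z = height p' + height u'
      \<or> z = p' + u' + v' \<and> height z = height p' + height u' + height v'"
    if "z \<in> {p', p' + u', p' + u' + v'}" for z
    using that by (elim insertE emptyE) (simp_all add: height_add)
  \<comment> \<open>Heights strictly increase along the chain of \<open>Q\<close>, so two vertices
    of \<open>Q\<close> whose heights differ by at least \<open>height u' + height v'\<close> must
    be its bottom and its top.\<close>
  have "p = p' \<and> p + u + v = p' + u' + v'"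
    using heights[OF ends(1)] heights[OF ends(2)] h height_add[of "p + u" v] height_add[of p u]
    by (elim disjE conjE) ((intro conjI; assumption) | linarith)+
  then have p: "p = p'" and "p + u + v = p' + u' + v'" by blast+
  then have "u + v = u' + v'" unfolding p add.assoc add_left_cancel by simp
  from chain_basis_same_sum[OF cb q(1) this] p show ?thesis
    using Q(1,2) q(2) by (elim disjE conjE) simp_all
qed

text \<open>The new corner \<open>p + v\<close> lies coordinatewise between \<open>p\<close> and
  \<open>p + u + v\<close>. Thus the rectangle extends to both sides of a long edge, and a neighbour
  exists there.\<close>

lemma tri_swap_subset_box:
  assumes "0 \<le> u" "0 \<le> v" "tri p u v \<subseteq> {a..b} \<times> {c..d}"
  shows "tri p v u \<subseteq> {a..b} \<times> {c..d}"
proof -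
  have "pt p \<in> tri p u v" "pt (p + u + v) \<in> tri p u v" by (simp_all add: tri_def hull_inc)
  then have e: "pt p \<in> {a..b} \<times> {c..d}" "pt (p + u + v) \<in> {a..b} \<times> {c..d}" using assms(3) by blast+
  have "pt (p + v) \<in> {a..b} \<times> {c..d}"
    using e assms(1,2) by (simp add: pt_def less_eq_prod_def)
  then have "{pt p, pt (p + v), pt (p + v + u)} \<subseteq> {a..b} \<times> {c..d}"
    using e by (simp add: ac_simps)
  then show ?thesis unfolding tri_def
    by (rule hull_minimal) (intro convex_Times convex_real_interval)
qed

text \<open>Suppose \<open>u\<close> leads in one coordinate and \<open>v\<close> in the other. By
  integrality both leads are at least 1, so the absolute determinant is at least 1 plus the smaller
  entry of each coordinate. These entries vanish, which leaves the unit vectors, of total height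
  2.\<close>

lemma chain_basis_comparable:
  assumes cb: "chain_basis u v" and h: "height (u + v) \<ge> 3"
  shows "u \<le> v \<or> v \<le> u"
proof (rule ccontr)
  assume not: "\<not> (u \<le> v \<or> v \<le> u)"
  have aux: False if "a \<ge> c + 1" "d \<ge> b + 1" "0 \<le> b" "0 \<le> c" "\<bar>a * d - b * c\<bar> = 1" "a + b + c + d \<ge> 3"
    for a b c d :: int
  proof -
    have "(c + 1) * (b + 1) \<le> a * d" using that by (intro mult_mono) linarith+
    then have "c + b + 1 \<le> a * d - b * c" by (simp add: algebra_simps)
    then have bc: "b = 0" "c = 0" using that by linarith+
    then have "a * d = 1" using \<open>c + b + 1 \<le> a * d - b * c\<close> that(5) by simp
    then have "a = 1" "d = 1" using that(1,2) bc by (simp_all add: zmult_eq_1_iff)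
    then show False using that(6) bc by simp
  qed
  obtain a b where u: "u = (a, b)" by (cases u)
  obtain c d where v: "v = (c, d)" by (cases v)
  have n: "0 \<le> a" "0 \<le> b" "0 \<le> c" "0 \<le> d" "\<bar>a * d - b * c\<bar> = 1" "a + b + c + d \<ge> 3"
    using cb h by (simp_all add: u v chain_basis_def less_eq_prod_def det2_def height_def)
  have "a > c \<and> b < d \<or> a < c \<and> b > d"
    using not by (auto simp: u v less_eq_prod_def)
  then show False
  proof
    assume "a > c \<and> b < d"
    then show False using aux[of c a b d] n by simp
  next
    assume "a < c \<and> b > d"
    then show False using aux[of a c d b] n by (simp add: algebra_simps abs_minus_commute)
  qed
qed

subsection \<open>The standard tiling\<close>

text \<open>These are the halves of the unit lattice squares cut along their rising diagonals. That
  they tile the rectangle emerges from the descent, which ends in this set.\<close>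

definition standard_tiling :: "point set \<Rightarrow> point set set" where
  "standard_tiling R = {P. \<exists>p u v. P = tri p u v \<and> chain_basis u v \<and> height (u + v) = 2 \<and> P \<subseteq> R}"

lemma unit_chain_basis:
  assumes cb: "chain_basis u v" and h: "height (u + v) = 2"
  shows "u = (1, 0) \<and> v = (0, 1) \<or> u = (0, 1) \<and> v = (1, 0)"
proof -
  have unit: "w = (1, 0) \<or> w = (0, 1)" if "0 \<le> w" "height w = 1" for w
  proof -
    obtain a b where w: "w = (a, b)" by (cases w)
    then have "0 \<le> a" "0 \<le> b" "a + b = 1" using that by (simp_all add: less_eq_prod_def height_def)
    then have "a = 1 \<and> b = 0 \<or> a = 0 \<and> b = 1" by linarith
    then show ?thesis using w by simp
  qed
  have "height u = 1" "height v = 1"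
    using chain_basis_height[OF cb] h by (simp_all add: height_add)
  then have "u = (1, 0) \<or> u = (0, 1)" "v = (1, 0) \<or> v = (0, 1)"
    using cb unit by (simp_all add: chain_basis_def)
  moreover have "u \<noteq> v" using cb by (auto simp: chain_basis_def det2_def)
  ultimately show ?thesis by blast
qed

text \<open>The test point is the centroid. Its coordinates have fractional parts 1/3 and 2/3: lying
  strictly between integers they determine the square, and their order determines the half.\<close>

lemma unit_triangles_disjoint:
  assumes cb: "chain_basis u v" "height (u + v) = 2" and cb': "chain_basis u' v'" "height (u' + v') = 2"
    and x: "comb p u v (2/3) (1/3) \<in> tri p' u' v'"
  shows "p' = p \<and> u' = u \<and> v' = v"
proof -
  obtain a b where p: "p = (a, b)" by (cases p)
  obtain a' b' where p': "p' = (a', b')" by (cases p')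
  from x obtain s t where st: "0 \<le> t" "t \<le> s" "s \<le> 1" "comb p u v (2/3) (1/3) = comb p' u' v' s t"
    unfolding mem_tri by (elim exE conjE)
  have aux: "k = l" if "real_of_int k + r = real_of_int l + q" "0 < r" "r < 1" "0 \<le> q" "q \<le> 1" for k l r q
  proof -
    have "real_of_int (k - l) < 1" "real_of_int (k - l) > - 1" using that by simp_all
    then show ?thesis by linarith
  qed
  have t: "0 \<le> t" "t \<le> 1" "0 \<le> s" "s \<le> 1" using st by linarith+
  show ?thesis
    using unit_chain_basis[OF cb] unit_chain_basis[OF cb']
  proof (elim disjE conjE)
    assume e: "u = (1, 0)" "v = (0, 1)" "u' = (1, 0)" "v' = (0, 1)"
    have "a + 2/3 = a' + s" "b + 1/3 = b' + t"
      using st(4) by (simp_all add: e p p' comb_def pt_def)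
    then have "a = a'" "b = b'" using t by (auto intro: aux)
    then show ?thesis by (simp add: e p p')
  next
    assume e: "u = (1, 0)" "v = (0, 1)" "u' = (0, 1)" "v' = (1, 0)"
    have eq: "a + 2/3 = a' + t" "b + 1/3 = b' + s"
      using st(4) by (simp_all add: e p p' comb_def pt_def)
    then have "a = a'" "b = b'" using t by (auto intro: aux)
    then show ?thesis using eq st(2) by simp
  next
    assume e: "u = (0, 1)" "v = (1, 0)" "u' = (1, 0)" "v' = (0, 1)"
    have eq: "a + 1/3 = a' + s" "b + 2/3 = b' + t"
      using st(4) by (simp_all add: e p p' comb_def pt_def)
    then have "a = a'" "b = b'" using t by (auto intro: aux)
    then show ?thesis using eq st(2) by simp
  next
    assume e: "u = (0, 1)" "v = (1, 0)" "u' = (0, 1)" "v' = (1, 0)"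
    have "a + 1/3 = a' + t" "b + 2/3 = b' + s"
      using st(4) by (simp_all add: e p p' comb_def pt_def)
    then have "a = a'" "b = b'" using t by (auto intro: aux)
    then show ?thesis by (simp add: e p p')
  qed
qed

text \<open>For the inclusion of the standard triangles in \<open>T\<close>, centroids suffice: the
  tile that contains the centroid of a standard triangle is that triangle itself.\<close>

lemma tiling_by_unit_triangles:
  assumes T: "tiling R T"
    and unit: "\<And>p u v. chain_basis u v \<Longrightarrow> tri p u v \<in> T \<Longrightarrow> height (u + v) \<le> 2"
  shows "T = standard_tiling R"
proof
  have tri: "\<exists>p u v. chain_basis u v \<and> P = tri p u v" if "P \<in> T" for P
    using T that by (simp add: tiling_def)
  have two: "height (u + v) = 2" if "chain_basis u v" "tri p u v \<in> T" for p u v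
    using unit[OF that] chain_basis_height[OF that(1)] by (simp add: height_add)
  have un: "\<Union>T = R" using T by (simp add: tiling_def)
  show "T \<subseteq> standard_tiling R"
  proof
    fix P assume P: "P \<in> T"
    from tri[OF P] obtain p u v where t: "chain_basis u v" "P = tri p u v" by (elim exE conjE)
    have "height (u + v) = 2" using two t P by simp
    moreover have "P \<subseteq> R" using P un by blast
    ultimately show "P \<in> standard_tiling R" unfolding standard_tiling_def using t by blast
  qed
  show "standard_tiling R \<subseteq> T"
  proof
    fix P assume "P \<in> standard_tiling R"
    then obtain p u v where t: "P = tri p u v" "chain_basis u v" "height (u + v) = 2" "P \<subseteq> R"
      unfolding standard_tiling_def mem_Collect_eq by (elim exE conjE)
    have "comb p u v (2/3) (1/3) \<in> P" unfolding t(1) mem_tri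
      by (rule exI[of _ "2/3"], rule exI[of _ "1/3"]) simp
    then have "comb p u v (2/3) (1/3) \<in> \<Union>T" using t(4) un by blast
    then obtain Q where Q: "Q \<in> T" "comb p u v (2/3) (1/3) \<in> Q" by blast
    from tri[OF Q(1)] obtain p' u' v' where q: "chain_basis u' v'" "Q = tri p' u' v'" by (elim exE conjE)
    have "height (u' + v') = 2" using two q Q(1) by simp
    from unit_triangles_disjoint[OF t(2,3) q(1) this] Q(2) have "p' = p \<and> u' = u \<and> v' = v"
      unfolding q(2) by blast
    then show "P \<in> T" using Q(1) q(2) t(1) by simp
  qed
qed

section \<open>Descent to the standard tiling\<close>

lemma flip_decreases:
  assumes T: "tiling R T" "finite T" and uv: "chain_basis (v + z) v" "0 \<le> z"
    and P: "tri p (v + z) v \<in> T" "tri p v (v + z) \<in> T"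
  shows "\<exists>T'. tiling R T' \<and> flip T T' \<and> flip T' T \<and> sum chain_length T' < sum chain_length T"
proof -
  let ?P1 = "tri p (v + z) v" and ?P2 = "tri p v (v + z)" and ?P3 = "tri p v z" and ?P4 = "tri (p + v) z v"
  let ?X = "T - {?P1, ?P2}"
  let ?T' = "?X \<union> {?P3, ?P4}"
  have cb: "chain_basis v (v + z)" "chain_basis z v" "chain_basis v z"
    using chain_basis_commute chain_basis_reduce uv by blast+
  have h: "height v \<ge> 1" "height z \<ge> 1" using chain_basis_height[OF cb(3)] .
  \<comment> \<open>The old triangles must count separately in the sum. For the new ones an upper
    bound is enough, so a coincidence there would do no harm.\<close>
  have ne: "?P1 \<noteq> ?P2"
  proof
    assume "?P1 = ?P2"
    moreover have "pt (p + (v + z)) \<in> ?P1" by (simp add: tri_def hull_inc)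
    ultimately have "p + (v + z) \<in> {p, p + v, p + v + (v + z)}"
      by (intro lattice_point_in_tri[OF cb(1)]) simp
    then have "v + z = 0 \<or> z = 0 \<or> v = 0" by (auto simp: algebra_simps)
    then show False using chain_basis_nonzero[OF uv(1)] chain_basis_nonzero[OF cb(2)] by blast
  qed
  have "sum chain_length T = sum chain_length ?X + (chain_length ?P1 + chain_length ?P2)"
    using sum.subset_diff[of "{?P1, ?P2}" T chain_length] T(2) P ne by simp
  moreover have "sum chain_length ?T' \<le> sum chain_length ?X + (chain_length ?P3 + chain_length ?P4)"
  proof -
    have "sum chain_length ?T' \<le> sum chain_length ?X + sum chain_length {?P3, ?P4}"
      using sum_Un_nat[of ?X "{?P3, ?P4}" chain_length] T(2) by simp
    also have "sum chain_length {?P3, ?P4} \<le> chain_length ?P3 + chain_length ?P4"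
      by (cases "?P3 = ?P4") simp_all
    finally show ?thesis by simp
  qed
  \<comment> \<open>Each of the two long edges shrinks from \<open>v + (v + z)\<close> to
    \<open>v + z\<close>, by \<open>height v \<ge> 1\<close>.\<close>
  moreover have "chain_length ?P3 + chain_length ?P4 < chain_length ?P1 + chain_length ?P2"
    unfolding chain_length_tri[OF cb(1)] chain_length_tri[OF cb(2)] chain_length_tri[OF cb(3)]
      chain_length_tri[OF uv(1)] height_add using h by simp
  ultimately have "sum chain_length ?T' < sum chain_length T" by linarith
  with flip_parallelogram[OF T(1) uv P] show ?thesis by (intro exI conjI)
qed

text \<open>Keeping the reverse flip in the relation makes it symmetric, so that two paths to the
  standard tiling can be joined.\<close>

definition flip_step :: "point set \<Rightarrow> point set set \<Rightarrow> point set set \<Rightarrow> bool" where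
  "flip_step R T T' \<longleftrightarrow> tiling R T \<and> tiling R T' \<and> flip T T' \<and> flip T' T"

lemma flips_to_standard_tiling:
  assumes mn: "m \<ge> 1" "n \<ge> 1"
  defines "R \<equiv> convex hull lattice_grid m n"
  assumes "tiling R T"
  shows "(flip_step R)\<^sup>*\<^sup>* T (standard_tiling R)"
  using \<open>tiling R T\<close>
proof (induction T rule: measure_induct_rule[of "sum chain_length"])
  case (less T)
  note T = less.prems
  have fin: "finite T" using finite_tiling[OF mn] T unfolding R_def .
  have tri: "\<exists>p u v. chain_basis u v \<and> P = tri p u v" if "P \<in> T" for P
    using T that by (simp add: tiling_def)
  show ?case
  proof (cases "\<forall>P\<in>T. chain_length P \<le> 2")
    case True
    have "T = standard_tiling R"
    proof (rule tiling_by_unit_triangles[OF T])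
      fix p u v assume "chain_basis u v" "tri p u v \<in> T"
      then show "height (u + v) \<le> 2" using True chain_length_tri[of u v p] by force
    qed
    then show ?thesis by simp
  next
    case False
    then obtain Q where Q: "Q \<in> T" "chain_length Q \<ge> 3" by force
    \<comment> \<open>The neighbour argument compares the long edge with those of all other tiles,
      hence the maximum over the whole of \<open>T\<close>.\<close>
    define M where "M = Max (chain_length ` T)"
    have "M \<in> chain_length ` T" unfolding M_def using fin Q(1) by (intro Max_in) auto
    then obtain P where P: "P \<in> T" "chain_length P = M" by auto
    have maxM: "chain_length S \<le> M" if "S \<in> T" for S
      unfolding M_def using fin that by (intro Max_ge) simp_all
    from tri[OF P(1)] obtain p u v where t: "chain_basis u v" "P = tri p u v" by (elim exE conjE)
    have uvT: "tri p u v \<in> T" using P(1) t(2) by simp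
    have h: "nat (height (u + v)) = M" using P(2) chain_length_tri[OF t(1)] t(2) by simp
    have M: "M \<ge> 3" using maxM[OF Q(1)] Q(2) by simp
    have pos: "0 \<le> u" "0 \<le> v" using t(1) unfolding chain_basis_def by simp_all
    have "\<Union>T = R" using T unfolding tiling_def by (elim conjE)
    with Union_upper[OF uvT] have "tri p u v \<subseteq> R" by simp
    then have sub: "tri p v u \<subseteq> R"
      unfolding R_def convex_hull_lattice_grid[OF mn] by (rule tri_swap_subset_box[OF pos])
    have max: "height (u' + v') \<le> height (u + v)"
      if a: "chain_basis u' v'" "tri p' u' v' \<in> T" for p' u' v'
    proof -
      have "nat (height (u' + v')) \<le> nat (height (u + v))"
        using maxM[OF a(2)] unfolding chain_length_tri[OF a(1)] h .
      then show ?thesis using h M by linarith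
    qed
    have vu: "tri p v u \<in> T"
      by (rule neighbour_across_long_edge[OF T fin t(1) uvT sub max])
    have "\<exists>T'. tiling R T' \<and> flip T T' \<and> flip T' T \<and> sum chain_length T' < sum chain_length T"
    proof -
      have "height (u + v) \<ge> 3" using h M by linarith
      from chain_basis_comparable[OF t(1) this] show ?thesis
      proof
        assume "v \<le> u"
        \<comment> \<open>The smaller step acts as the \<open>v\<close> of the flip and the
          difference of the steps as its \<open>z\<close>.\<close>
        then have z: "0 \<le> u - v" "v + (u - v) = u" by (simp_all add: less_eq_prod_def)
        show ?thesis
          using flip_decreases[OF T fin, of v "u - v" p] unfolding z(2) using t(1) z(1) uvT vu by blast
      next
        assume "u \<le> v"
        then have z: "0 \<le> v - u" "u + (v - u) = v" by (simp_all add: less_eq_prod_def)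
        show ?thesis
          using flip_decreases[OF T fin, of u "v - u" p] unfolding z(2)
          using chain_basis_commute[OF t(1)] z(1) uvT vu by blast
      qed
    qed
    then obtain T' where T': "tiling R T'" "flip T T'" "flip T' T" "sum chain_length T' < sum chain_length T"
      by (elim exE conjE)
    have "flip_step R T T'" using T T' by (simp add: flip_step_def)
    moreover have "(flip_step R)\<^sup>*\<^sup>* T' (standard_tiling R)" using less.IH[OF T'(4,1)] .
    ultimately show ?thesis by (rule converse_rtranclp_into_rtranclp)
  qed
qed

theorem theorem4:
  fixes m n :: nat and T T' :: "point set set"
  assumes "m \<ge> 2" and "n \<ge> 2"
    and "full_bimonotone_triangulation (lattice_grid m n) T"
    and "full_bimonotone_triangulation (lattice_grid m n) T'"
  shows "\<exists>(k::nat) (S :: nat \<Rightarrow> point set set).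
           S 0 = T \<and> S k = T' \<and>
           (\<forall>i\<le>k. full_bimonotone_triangulation (lattice_grid m n) (S i)) \<and>
           (\<forall>i<k. flip (S i) (S (Suc i)))"
proof -
  define R where "R = convex hull lattice_grid m n"
  have mn: "m \<ge> 1" "n \<ge> 1" using assms(1,2) by simp_all
  have to_standard: "(flip_step R)\<^sup>*\<^sup>* T (standard_tiling R)" "(flip_step R)\<^sup>*\<^sup>* T' (standard_tiling R)"
    unfolding R_def
    using full_imp_tiling[OF mn assms(3)] full_imp_tiling[OF mn assms(4)]
    by (simp_all add: flips_to_standard_tiling[OF mn])
  have "(flip_step R)\<inverse>\<inverse> = flip_step R"
    unfolding fun_eq_iff flip_step_def conversep_iff by blast
  with rtranclp_converseI[OF to_standard(2)] have "(flip_step R)\<^sup>*\<^sup>* (standard_tiling R) T'"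
    by simp
  with to_standard(1) have "(flip_step R)\<^sup>*\<^sup>* T T'" by (rule rtranclp_trans)
  then obtain k where "(flip_step R ^^ k) T T'" unfolding rtranclp_power ..
  then obtain S where S: "S 0 = T" "S k = T'" "\<forall>i<k. flip_step R (S i) (S (Suc i))"
    unfolding relpowp_fun_conv by (elim exE conjE)
  \<comment> \<open>For \<open>k = 0\<close> there is no step to vouch for \<open>S 0\<close>, so
    the start is taken from the assumption and every later term from the step leading to it.\<close>
  have "full_bimonotone_triangulation (lattice_grid m n) (S i)" if "i \<le> k" for i
  proof (cases i)
    case 0
    then show ?thesis using S(1) assms(3) by simp
  next
    case (Suc j)
    then have "flip_step R (S j) (S i)" using S(3) that by simp
    then show ?thesis using tiling_imp_full[OF mn] by (simp add: flip_step_def R_def)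
  qed
  moreover have "\<forall>i<k. flip (S i) (S (Suc i))" using S(3) by (simp add: flip_step_def)
  ultimately show ?thesis using S(1,2) by blast
qed

end
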